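(* Let $\Gamma_v$ be a closed web, and let $\zeta$ and $\zeta'$ be two complete identifications of its vertices. Then the matrix factorizations $\zeta(\hat\Gamma_v)$ and $\zeta'(\hat\Gamma_v)$ are isomorphic, up to a shift in the $\mathbb{Z}/2\mathbb{Z}$-grading.
   Context: **Webs.** A web is an oriented trivalent graph (circles without vertices allowed) such that at each vertex either all three edges are oriented into it ($(-)$-type) or all three away from it ($(+)$-type). It is closed if it has no free ends; then there are equally many vertices of both types. Each edge carries at least one mark, and each mark has a variable. **Matrix factorizations.** All rings are polynomial rings over $\mathbb{Q}$ containing $\mathbb{Q}[a,b,c]$, with $q(a)=2$, $q(b)=4$, $q(c)=6$, and edge variables of degree $2$. A matrix factorization over $R$ with homogeneous potential $W\in R$ of degree $2m$ is a $\mathbb{Z}/2\mathbb{Z}$-graded, $\mathbb{Z}$-graded free $R$-module $M_0\oplus M_1$ with degree-$m$ maps $M_0\xrightarrow{d_0}M_1\xrightarrow{d_1}M_0$, $d_1d_0=W$, $d_0d_1=W$. $\{j\}$ is the shift of the $\mathbb{Z}$-grading by $j$, and the shift of the $\mathbb{Z}/2\mathbb{Z}$-grading is $M\langle1\rangle=(M_1\xrightarrow{-d_1}M_0\xrightarrow{-d_0}M_1)$. A homomorphism is a pair $(f_0,f_1)$ of maps of the same degree commuting with the differentials; it is an isomorphism if $f_0$ and $f_1$ are isomorphisms of the underlying modules. $\{A,B\}$ denotes $R\xrightarrow{A}R\{\frac12(\deg B-\deg A)\}\xrightarrow{B}R$, and a Koszul matrix with rows $(A_i,B_i)$ denotes the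 tensor product over $R$ of the factorizations $\{A_i,B_i\}$. **Factorizations of a web.** Let $p(x)=x^4-\frac{4a}{3}x^3-2bx^2-4cx$. An arc oriented from mark $y$ to mark $x$ is assigned $\{\frac{p(x)-p(y)}{x-y},\,x-y\}$. For sequences $e=(e_1,e_2,e_3)$, $v=(v_1,v_2,v_3)$ put $$g_1(e;v)=\tfrac{e_1^4-v_1^4}{e_1-v_1}-4e_2(e_1+v_1)+4e_3-\tfrac{4a}{3}\Big(\tfrac{e_1^3-v_1^3}{e_1-v_1}-3e_2\Big)-2b(e_1+v_1)-4c,$$ $$g_2(e;v)=2(e_2+v_2)-4v_1^2+4av_1+4b,\qquad g_3(e;v)=4(v_1-a).$$ To a $(+)$-vertex with outgoing marks $x,y,z$, whose elementary symmetric polynomials are $e_1,e_2,e_3$, one assigns, using new vertex variables $v_1,v_2,v_3$ with $q(v_i)=2i$, the Koszul matrix with rows $(g_i(e;v),\,e_i-v_i)$, $i=1,2,3$, shifted by $-3/2$ in the $q$-grading and by $1/2$ in the $\mathbb{Z}/2\mathbb{Z}$-grading. To a $(-)$-vertex with incoming marks one assigns the Koszul matrix with rows $(g_i(e;v),\,v_i-e_i)$ with the same shift. $\hat\Gamma_v$ is the tensor product of all arc and vertex factorizations. **Complete identification.** A complete identification $\zeta$ is a pairing (bijection) of the $(+)$-vertices with the $(-)$-vertices of $\Gamma_v$. $\zeta(\hat\Gamma_v)$ is obtained from $\hat\Gamma_v$ by identifying the vertex variables of paired vertices and then excluding all vertex variables. Explicitly, $\zeta(\hat\Gamma_v)$ is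 the tensor product of all arc factorizations and, for each pair consisting of a $(+)$-vertex (whose outgoing marks have elementary symmetric polynomials $e_1,e_2,e_3$) and a $(-)$-vertex (whose incoming marks have elementary symmetric polynomials $s_1,s_2,s_3$), the Koszul matrix with rows $(g_i(e;s),\,e_i-s_i)$, $i=1,2,3$, shifted by $\{-3\}\langle1\rangle$. For a closed web its potential is $0$. *)

theory Defs
  imports Complex_Main "HOL-Library.Poly_Mapping"
begin

section \<open>Graded polynomial rings over the rationals\<close>

datatype 'e var = Par_a | Par_b | Par_c | Mark 'e nat

type_synonym 'e mpoly = "('e var \<Rightarrow>\<^sub>0 nat) \<Rightarrow>\<^sub>0 rat"

definition Var :: "'e var \<Rightarrow> 'e mpoly" where
  "Var x = Poly_Mapping.single (Poly_Mapping.single x 1) 1"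

definition Const :: "rat \<Rightarrow> 'e mpoly" where
  "Const r = Poly_Mapping.single 0 r"

definition poly_ring :: "'e var set \<Rightarrow> 'e mpoly set" where
  "poly_ring X = {f. \<forall>m\<in>Poly_Mapping.keys f. Poly_Mapping.keys m \<subseteq> X}"

fun var_deg :: "'e var \<Rightarrow> int" where
  "var_deg Par_a = 2"
| "var_deg Par_b = 4"
| "var_deg Par_c = 6"
| "var_deg (Mark e i) = 2"

definition mon_deg :: "('e var \<Rightarrow>\<^sub>0 nat) \<Rightarrow> int" where
  "mon_deg m = (\<Sum>x\<in>Poly_Mapping.keys m. int (Poly_Mapping.lookup m x) * var_deg x)"

definition homog :: "int \<Rightarrow> 'e mpoly \<Rightarrow> bool" where
  "homog k f \<longleftrightarrow> (\<forall>m\<in>Poly_Mapping.keys f. mon_deg m = k)"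


section \<open>Matrix factorizations\<close>

text \<open>
  A free graded module \<open>M\<^sub>0 \<oplus> M\<^sub>1\<close> is given by a finite set of homogeneous generators, each with a
  parity and a degree; \<open>mf_coef M h g\<close> is the coefficient of the generator \<open>h\<close> in the differential
  of the generator \<open>g\<close>. A single type of generators closed under pairing allows iterated tensor
  products.
\<close>

datatype gen = Even_gen | Odd_gen | Tensor_gen gen gen

record 'e mf =
  mf_gens :: "gen set"
  mf_odd :: "gen \<Rightarrow> bool"
  mf_deg :: "gen \<Rightarrow> int"
  mf_coef :: "gen \<Rightarrow> gen \<Rightarrow> 'e mpoly"

definition mf_even_gens :: "'e mf \<Rightarrow> gen set" where
  "mf_even_gens M = {g \<in> mf_gens M. \<not> mf_odd M g}"

definition mf_odd_gens :: "'e mf \<Rightarrow> gen set" where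
  "mf_odd_gens M = {g \<in> mf_gens M. mf_odd M g}"

definition free_module :: "'e mpoly set \<Rightarrow> gen set \<Rightarrow> (gen \<Rightarrow> 'e mpoly) set" where
  "free_module R G = {u. (\<forall>g\<in>G. u g \<in> R) \<and> (\<forall>g. g \<notin> G \<longrightarrow> u g = 0)}"

abbreviation mf_module0 :: "'e mpoly set \<Rightarrow> 'e mf \<Rightarrow> (gen \<Rightarrow> 'e mpoly) set" where
  "mf_module0 R M \<equiv> free_module R (mf_even_gens M)"

abbreviation mf_module1 :: "'e mpoly set \<Rightarrow> 'e mf \<Rightarrow> (gen \<Rightarrow> 'e mpoly) set" where
  "mf_module1 R M \<equiv> free_module R (mf_odd_gens M)"

definition mf_homog :: "'e mf \<Rightarrow> int \<Rightarrow> (gen \<Rightarrow> 'e mpoly) \<Rightarrow> bool" where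
  "mf_homog M k u \<longleftrightarrow> (\<forall>g\<in>mf_gens M. homog (k - mf_deg M g) (u g))"

definition mf_d0 :: "'e mf \<Rightarrow> (gen \<Rightarrow> 'e mpoly) \<Rightarrow> gen \<Rightarrow> 'e mpoly" where
  "mf_d0 M u = (\<lambda>h. if h \<in> mf_odd_gens M then (\<Sum>g\<in>mf_even_gens M. mf_coef M h g * u g) else 0)"

definition mf_d1 :: "'e mf \<Rightarrow> (gen \<Rightarrow> 'e mpoly) \<Rightarrow> gen \<Rightarrow> 'e mpoly" where
  "mf_d1 M u = (\<lambda>h. if h \<in> mf_even_gens M then (\<Sum>g\<in>mf_odd_gens M. mf_coef M h g * u g) else 0)"

definition linear_map ::
  "'e mpoly set \<Rightarrow> (gen \<Rightarrow> 'e mpoly) set \<Rightarrow> (gen \<Rightarrow> 'e mpoly) set \<Rightarrow>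
    ((gen \<Rightarrow> 'e mpoly) \<Rightarrow> gen \<Rightarrow> 'e mpoly) \<Rightarrow> bool" where
  "linear_map R U V f \<longleftrightarrow>
     (\<forall>u\<in>U. f u \<in> V) \<and>
     (\<forall>u\<in>U. \<forall>v\<in>U. f (\<lambda>g. u g + v g) = (\<lambda>h. f u h + f v h)) \<and>
     (\<forall>r\<in>R. \<forall>u\<in>U. f (\<lambda>g. r * u g) = (\<lambda>h. r * f u h))"

definition graded_map ::
  "'e mf \<Rightarrow> 'e mf \<Rightarrow> int \<Rightarrow> (gen \<Rightarrow> 'e mpoly) set \<Rightarrow>
    ((gen \<Rightarrow> 'e mpoly) \<Rightarrow> gen \<Rightarrow> 'e mpoly) \<Rightarrow> bool" where
  "graded_map M N k U f \<longleftrightarrow> (\<forall>n. \<forall>u\<in>U. mf_homog M n u \<longrightarrow> mf_homog N (n + k) (f u))"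

definition matrix_factorization :: "'e mpoly set \<Rightarrow> int \<Rightarrow> 'e mpoly \<Rightarrow> 'e mf \<Rightarrow> bool" where
  "matrix_factorization R m W M \<longleftrightarrow>
     W \<in> R \<and> homog (2 * m) W \<and> finite (mf_gens M) \<and>
     linear_map R (mf_module0 R M) (mf_module1 R M) (mf_d0 M) \<and>
     linear_map R (mf_module1 R M) (mf_module0 R M) (mf_d1 M) \<and>
     graded_map M M m (mf_module0 R M) (mf_d0 M) \<and>
     graded_map M M m (mf_module1 R M) (mf_d1 M) \<and>
     (\<forall>u\<in>mf_module0 R M. mf_d1 M (mf_d0 M u) = (\<lambda>g. W * u g)) \<and>
     (\<forall>u\<in>mf_module1 R M. mf_d0 M (mf_d1 M u) = (\<lambda>g. W * u g))"

definition mf_hom ::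
  "'e mpoly set \<Rightarrow> int \<Rightarrow> 'e mf \<Rightarrow> 'e mf \<Rightarrow>
    ((gen \<Rightarrow> 'e mpoly) \<Rightarrow> gen \<Rightarrow> 'e mpoly) \<Rightarrow>
    ((gen \<Rightarrow> 'e mpoly) \<Rightarrow> gen \<Rightarrow> 'e mpoly) \<Rightarrow> bool" where
  "mf_hom R k M N f0 f1 \<longleftrightarrow>
     linear_map R (mf_module0 R M) (mf_module0 R N) f0 \<and>
     linear_map R (mf_module1 R M) (mf_module1 R N) f1 \<and>
     graded_map M N k (mf_module0 R M) f0 \<and>
     graded_map M N k (mf_module1 R M) f1 \<and>
     (\<forall>u\<in>mf_module0 R M. f1 (mf_d0 M u) = mf_d0 N (f0 u)) \<and>
     (\<forall>u\<in>mf_module1 R M. f0 (mf_d1 M u) = mf_d1 N (f1 u))"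

definition mf_iso ::
  "'e mpoly set \<Rightarrow> int \<Rightarrow> 'e mf \<Rightarrow> 'e mf \<Rightarrow>
    ((gen \<Rightarrow> 'e mpoly) \<Rightarrow> gen \<Rightarrow> 'e mpoly) \<Rightarrow>
    ((gen \<Rightarrow> 'e mpoly) \<Rightarrow> gen \<Rightarrow> 'e mpoly) \<Rightarrow> bool" where
  "mf_iso R k M N f0 f1 \<longleftrightarrow>
     mf_hom R k M N f0 f1 \<and>
     bij_betw f0 (mf_module0 R M) (mf_module0 R N) \<and>
     bij_betw f1 (mf_module1 R M) (mf_module1 R N)"

text \<open>Isomorphic without any shift of the \<open>\<int>\<close>-grading, hence by maps of degree \<open>0\<close>.\<close>

definition mf_isomorphic :: "'e mpoly set \<Rightarrow> 'e mf \<Rightarrow> 'e mf \<Rightarrow> bool" where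
  "mf_isomorphic R M N \<longleftrightarrow> (\<exists>f0 f1. mf_iso R 0 M N f0 f1)"

definition shift_q :: "int \<Rightarrow> 'e mf \<Rightarrow> 'e mf" where
  "shift_q j M = M\<lparr>mf_deg := \<lambda>g. mf_deg M g + j\<rparr>"

definition shift_1 :: "'e mf \<Rightarrow> 'e mf" where
  "shift_1 M = M\<lparr>mf_odd := \<lambda>g. \<not> mf_odd M g, mf_coef := \<lambda>h g. - mf_coef M h g\<rparr>"

text \<open>
  The degrees of \<open>A\<close> and \<open>B\<close> are arguments because an entry such as \<open>x - y\<close> or \<open>e\<^sub>i - s\<^sub>i\<close> vanishes
  when both sides involve the same marks; its degree is then still that of the generic expression.
\<close>

definition elem_mf :: "'e mpoly \<Rightarrow> int \<Rightarrow> 'e mpoly \<Rightarrow> int \<Rightarrow> 'e mf" where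
  "elem_mf A degA B degB =
     \<lparr>mf_gens = {Even_gen, Odd_gen},
      mf_odd = (\<lambda>g. g = Odd_gen),
      mf_deg = (\<lambda>g. if g = Odd_gen then (degB - degA) div 2 else 0),
      mf_coef = (\<lambda>h g. if h = Odd_gen \<and> g = Even_gen then A
                     else if h = Even_gen \<and> g = Odd_gen then B else 0)\<rparr>"

text \<open>The differential is \<open>d (u \<otimes> v) = d u \<otimes> v + (-1)\<^bsup>|u|\<^esup> u \<otimes> d v\<close>.\<close>

fun tensor_odd :: "'e mf \<Rightarrow> 'e mf \<Rightarrow> gen \<Rightarrow> bool" where
  "tensor_odd M N (Tensor_gen g g') \<longleftrightarrow> mf_odd M g \<noteq> mf_odd N g'"
| "tensor_odd M N _ \<longleftrightarrow> False"

fun tensor_deg :: "'e mf \<Rightarrow> 'e mf \<Rightarrow> gen \<Rightarrow> int" where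
  "tensor_deg M N (Tensor_gen g g') = mf_deg M g + mf_deg N g'"
| "tensor_deg M N _ = 0"

fun tensor_coef :: "'e mf \<Rightarrow> 'e mf \<Rightarrow> gen \<Rightarrow> gen \<Rightarrow> 'e mpoly" where
  "tensor_coef M N (Tensor_gen h h') (Tensor_gen g g') =
     (if h' = g' then mf_coef M h g else 0) +
     (if h = g then (if mf_odd M g then - mf_coef N h' g' else mf_coef N h' g') else 0)"
| "tensor_coef M N _ _ = 0"

definition mf_tensor :: "'e mf \<Rightarrow> 'e mf \<Rightarrow> 'e mf" where
  "mf_tensor M N =
     \<lparr>mf_gens = (\<lambda>(g, g'). Tensor_gen g g') ` (mf_gens M \<times> mf_gens N),
      mf_odd = tensor_odd M N,
      mf_deg = tensor_deg M N,
      mf_coef = tensor_coef M N\<rparr>"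

definition mf_unit :: "'e mf" where
  "mf_unit = \<lparr>mf_gens = {Even_gen}, mf_odd = (\<lambda>g. False), mf_deg = (\<lambda>g. 0), mf_coef = (\<lambda>h g. 0)\<rparr>"

definition mf_tensor_list :: "'e mf list \<Rightarrow> 'e mf" where
  "mf_tensor_list Ms = foldr mf_tensor Ms mf_unit"


section \<open>Webs\<close>

text \<open>
  \<open>edges\<close> are the edges that are intervals, \<open>circles\<close> those without vertices; an end of an interval
  is \<open>None\<close> if it is free. The marks on an edge \<open>e\<close> are \<open>(e, 0), \<dots>, (e, n - 1)\<close> with
  \<open>n = marks \<Gamma> e\<close>, numbered along the orientation (cyclically if \<open>e\<close> is a circle).
\<close>

record ('v, 'e) web =
  verts :: "'v set"
  edges :: "'e set"
  circles :: "'e set"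
  tail :: "'e \<Rightarrow> 'v option"
  head :: "'e \<Rightarrow> 'v option"
  marks :: "'e \<Rightarrow> nat"

definition out_edges :: "('v, 'e) web \<Rightarrow> 'v \<Rightarrow> 'e set" where
  "out_edges \<Gamma> v = {e \<in> edges \<Gamma>. tail \<Gamma> e = Some v}"

definition in_edges :: "('v, 'e) web \<Rightarrow> 'v \<Rightarrow> 'e set" where
  "in_edges \<Gamma> v = {e \<in> edges \<Gamma>. head \<Gamma> e = Some v}"

definition plus_verts :: "('v, 'e) web \<Rightarrow> 'v set" where
  "plus_verts \<Gamma> = {v \<in> verts \<Gamma>. card (out_edges \<Gamma> v) = 3 \<and> in_edges \<Gamma> v = {}}"

definition minus_verts :: "('v, 'e) web \<Rightarrow> 'v set" where
  "minus_verts \<Gamma> = {v \<in> verts \<Gamma>. card (in_edges \<Gamma> v) = 3 \<and> out_edges \<Gamma> v = {}}"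

definition is_web :: "('v, 'e) web \<Rightarrow> bool" where
  "is_web \<Gamma> \<longleftrightarrow>
     finite (verts \<Gamma>) \<and> finite (edges \<Gamma>) \<and> finite (circles \<Gamma>) \<and> edges \<Gamma> \<inter> circles \<Gamma> = {} \<and>
     (\<forall>e\<in>edges \<Gamma>. set_option (tail \<Gamma> e) \<subseteq> verts \<Gamma> \<and> set_option (head \<Gamma> e) \<subseteq> verts \<Gamma>) \<and>
     (\<forall>v\<in>verts \<Gamma>. v \<in> plus_verts \<Gamma> \<or> v \<in> minus_verts \<Gamma>) \<and>
     (\<forall>e\<in>edges \<Gamma> \<union> circles \<Gamma>. marks \<Gamma> e \<ge> 1)"

definition closed_web :: "('v, 'e) web \<Rightarrow> bool" where
  "closed_web \<Gamma> \<longleftrightarrow> is_web \<Gamma> \<and> (\<forall>e\<in>edges \<Gamma>. tail \<Gamma> e \<noteq> None \<and> head \<Gamma> e \<noteq> None)"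

definition complete_identification :: "('v, 'e) web \<Rightarrow> ('v \<Rightarrow> 'v) \<Rightarrow> bool" where
  "complete_identification \<Gamma> \<zeta> \<longleftrightarrow> bij_betw \<zeta> (plus_verts \<Gamma>) (minus_verts \<Gamma>)"

text \<open>An arc is a pair of consecutive marks \<open>(y, x)\<close>, oriented from \<open>y\<close> to \<open>x\<close>.\<close>

definition arcs :: "('v, 'e) web \<Rightarrow> (('e \<times> nat) \<times> ('e \<times> nat)) set" where
  "arcs \<Gamma> = {((e, i), (e, Suc i)) |e i. e \<in> edges \<Gamma> \<and> Suc i < marks \<Gamma> e} \<union>
            {((e, i), (e, Suc i mod marks \<Gamma> e)) |e i. e \<in> circles \<Gamma> \<and> i < marks \<Gamma> e}"

definition web_ring :: "('v, 'e) web \<Rightarrow> 'e mpoly set" where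
  "web_ring \<Gamma> = poly_ring ({Par_a, Par_b, Par_c} \<union>
                           {Mark e i |e i. e \<in> edges \<Gamma> \<union> circles \<Gamma> \<and> i < marks \<Gamma> e})"


section \<open>Factorizations of a web\<close>

text \<open>The polynomial \<open>(x\<^sup>n - y\<^sup>n) / (x - y)\<close>, which makes sense also for \<open>x = y\<close>.\<close>

definition pow_quot :: "nat \<Rightarrow> 'e mpoly \<Rightarrow> 'e mpoly \<Rightarrow> 'e mpoly" where
  "pow_quot n x y = (\<Sum>i<n. x ^ i * y ^ (n - 1 - i))"

lemma pow_quot: "pow_quot n x y * (x - y) = x ^ n - y ^ n"
  unfolding pow_quot_def
  by (simp add: power_diff_sumr2 mult.commute)

definition p_pol :: "'e mpoly \<Rightarrow> 'e mpoly" where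
  "p_pol x = x ^ 4 - Const (4/3) * Var Par_a * x ^ 3 - 2 * Var Par_b * x ^ 2 - 4 * Var Par_c * x"

definition p_quot :: "'e mpoly \<Rightarrow> 'e mpoly \<Rightarrow> 'e mpoly" where
  "p_quot x y = pow_quot 4 x y - Const (4/3) * Var Par_a * pow_quot 3 x y
                - 2 * Var Par_b * pow_quot 2 x y - 4 * Var Par_c"

lemma p_quot: "p_quot x y * (x - y) = p_pol x - p_pol y"
proof -
  have "p_quot x y * (x - y) =
      pow_quot 4 x y * (x - y) - Const (4/3) * Var Par_a * (pow_quot 3 x y * (x - y))
      - 2 * Var Par_b * (pow_quot 2 x y * (x - y)) - 4 * Var Par_c * (x - y)"
    unfolding p_quot_def by (simp only: left_diff_distrib mult.assoc)
  then show ?thesis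
    unfolding pow_quot p_pol_def by (simp only: right_diff_distrib) simp
qed

definition arc_mf :: "('e \<times> nat) \<times> ('e \<times> nat) \<Rightarrow> 'e mf" where
  "arc_mf = (\<lambda>((e, i), (e', j)). let y = Var (Mark e i); x = Var (Mark e' j) in
     elem_mf (p_quot x y) 6 (x - y) 2)"

definition esym :: "('e \<Rightarrow> 'e mpoly) \<Rightarrow> 'e set \<Rightarrow> nat \<Rightarrow> 'e mpoly" where
  "esym x S k = (\<Sum>T\<in>{T. T \<subseteq> S \<and> card T = k}. \<Prod>t\<in>T. x t)"

definition out_esym :: "('v, 'e) web \<Rightarrow> 'v \<Rightarrow> nat \<Rightarrow> 'e mpoly" where
  "out_esym \<Gamma> v = esym (\<lambda>e. Var (Mark e 0)) (out_edges \<Gamma> v)"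

definition in_esym :: "('v, 'e) web \<Rightarrow> 'v \<Rightarrow> nat \<Rightarrow> 'e mpoly" where
  "in_esym \<Gamma> v = esym (\<lambda>e. Var (Mark e (marks \<Gamma> e - 1))) (in_edges \<Gamma> v)"

definition g1_pol :: "(nat \<Rightarrow> 'e mpoly) \<Rightarrow> (nat \<Rightarrow> 'e mpoly) \<Rightarrow> 'e mpoly" where
  "g1_pol e v = pow_quot 4 (e 1) (v 1) - 4 * e 2 * (e 1 + v 1) + 4 * e 3
                - Const (4/3) * Var Par_a * (pow_quot 3 (e 1) (v 1) - 3 * e 2)
                - 2 * Var Par_b * (e 1 + v 1) - 4 * Var Par_c"

definition g2_pol :: "(nat \<Rightarrow> 'e mpoly) \<Rightarrow> (nat \<Rightarrow> 'e mpoly) \<Rightarrow> 'e mpoly" where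
  "g2_pol e v = 2 * (e 2 + v 2) - 4 * v 1 ^ 2 + 4 * Var Par_a * v 1 + 4 * Var Par_b"

definition g3_pol :: "(nat \<Rightarrow> 'e mpoly) \<Rightarrow> (nat \<Rightarrow> 'e mpoly) \<Rightarrow> 'e mpoly" where
  "g3_pol e v = 4 * (v 1 - Var Par_a)"

definition pair_mf :: "(nat \<Rightarrow> 'e mpoly) \<Rightarrow> (nat \<Rightarrow> 'e mpoly) \<Rightarrow> 'e mf" where
  "pair_mf e s = shift_1 (shift_q (- 3) (mf_tensor_list
     [elem_mf (g1_pol e s) 6 (e 1 - s 1) 2,
      elem_mf (g2_pol e s) 4 (e 2 - s 2) 4,
      elem_mf (g3_pol e s) 2 (e 3 - s 3) 6]))"

text \<open>
  The arguments \<open>as\<close> and \<open>vs\<close> enumerate the arcs and the \<open>(+)\<close>-vertices; they fix the order of the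
  factors in the tensor product.
\<close>

definition identified_mf ::
  "('v, 'e) web \<Rightarrow> (('e \<times> nat) \<times> ('e \<times> nat)) list \<Rightarrow> 'v list \<Rightarrow> ('v \<Rightarrow> 'v) \<Rightarrow> 'e mf" where
  "identified_mf \<Gamma> as vs \<zeta> = mf_tensor_list
     (map arc_mf as @ map (\<lambda>v. pair_mf (out_esym \<Gamma> v) (in_esym \<Gamma> (\<zeta> v))) vs)"


section \<open>The factorizations of a closed web have potential zero\<close>

lemma keys_uminus: "Poly_Mapping.keys (- f) = Poly_Mapping.keys (f :: 'e mpoly)"
  by (auto simp: in_keys_iff)

lemma poly_ring_0 [simp]: "0 \<in> poly_ring X" by (simp add: poly_ring_def)

lemma poly_ring_single: "Poly_Mapping.keys m \<subseteq> X \<Longrightarrow> Poly_Mapping.single m r \<in> poly_ring X"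
  by (auto simp: poly_ring_def)

lemma poly_ring_1 [simp]: "1 \<in> poly_ring X"
  using poly_ring_single[of 0 X 1] by simp

lemma poly_ring_Const [simp]: "Const r \<in> poly_ring X"
  by (simp add: Const_def poly_ring_single)

lemma poly_ring_Var [simp]: "x \<in> X \<Longrightarrow> Var x \<in> poly_ring X"
  by (simp add: Var_def poly_ring_single)

lemma poly_ring_add: "f \<in> poly_ring X \<Longrightarrow> g \<in> poly_ring X \<Longrightarrow> f + g \<in> poly_ring X"
  using Poly_Mapping.keys_add[of f g] by (fastforce simp: poly_ring_def)

lemma poly_ring_minus: "f \<in> poly_ring X \<Longrightarrow> - f \<in> poly_ring X"
  by (simp add: poly_ring_def keys_uminus)

lemma poly_ring_diff: "f \<in> poly_ring X \<Longrightarrow> g \<in> poly_ring X \<Longrightarrow> f - g \<in> poly_ring X"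
  using poly_ring_add[of f X "- g"] poly_ring_minus[of g X] by simp

lemma poly_ring_mult:
  assumes "f \<in> poly_ring X" "g \<in> poly_ring X" shows "f * g \<in> poly_ring X"
  unfolding poly_ring_def
proof (intro CollectI ballI)
  fix m assume "m \<in> Poly_Mapping.keys (f * g)"
  then obtain a b where "a \<in> Poly_Mapping.keys f" "b \<in> Poly_Mapping.keys g" "m = a + b"
    using keys_mult[of f g] by blast
  then show "Poly_Mapping.keys m \<subseteq> X"
    using assms Poly_Mapping.keys_add[of a b] by (fastforce simp: poly_ring_def)
qed

lemma poly_ring_sum: "(\<And>i. i \<in> I \<Longrightarrow> f i \<in> poly_ring X) \<Longrightarrow> sum f I \<in> poly_ring X"
  by (induction I rule: infinite_finite_induct) (auto intro: poly_ring_add)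

lemma poly_ring_prod: "(\<And>i. i \<in> I \<Longrightarrow> f i \<in> poly_ring X) \<Longrightarrow> prod f I \<in> poly_ring X"
  by (induction I rule: infinite_finite_induct) (auto intro: poly_ring_mult)

lemma poly_ring_power: "f \<in> poly_ring X \<Longrightarrow> f ^ n \<in> poly_ring X"
  by (induction n) (auto intro: poly_ring_mult)

lemma poly_ring_numeral [simp]: "numeral n \<in> poly_ring X"
proof -
  have "of_nat k \<in> poly_ring X" for k by (induction k) (auto intro: poly_ring_add)
  from this[of "numeral n"] show ?thesis by simp
qed

lemmas poly_ring_closed = poly_ring_add poly_ring_minus poly_ring_diff poly_ring_mult
  poly_ring_sum poly_ring_prod poly_ring_power

lemma mon_deg_eq: "finite S \<Longrightarrow> Poly_Mapping.keys m \<subseteq> S \<Longrightarrow>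
   mon_deg m = (\<Sum>x\<in>S. int (Poly_Mapping.lookup m x) * var_deg x)"
  unfolding mon_deg_def by (rule sum.mono_neutral_left) (auto simp: in_keys_iff)

lemma mon_deg_add: "mon_deg (a + b) = mon_deg a + mon_deg b"
proof -
  let ?S = "Poly_Mapping.keys a \<union> Poly_Mapping.keys b"
  have "mon_deg (a + b) = (\<Sum>x\<in>?S. int (Poly_Mapping.lookup (a+b) x) * var_deg x)"
    using Poly_Mapping.keys_add[of a b] by (intro mon_deg_eq) auto
  also have "\<dots> = (\<Sum>x\<in>?S. int (Poly_Mapping.lookup a x) * var_deg x) + (\<Sum>x\<in>?S. int (Poly_Mapping.lookup b x) * var_deg x)"
    by (simp add: lookup_add algebra_simps sum.distrib)
  also have "\<dots> = mon_deg a + mon_deg b"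
    by (subst (1 2) mon_deg_eq[of ?S]) auto
  finally show ?thesis .
qed

lemma homog_0 [simp]: "homog k 0" by (simp add: homog_def)

lemma homog_add: "homog k f \<Longrightarrow> homog k g \<Longrightarrow> homog k (f + g)"
  using Poly_Mapping.keys_add[of f g] by (fastforce simp: homog_def)

lemma homog_minus: "homog k f \<Longrightarrow> homog k (- f)"
  by (simp add: homog_def keys_uminus)

lemma homog_diff: "homog k f \<Longrightarrow> homog k g \<Longrightarrow> homog k (f - g)"
  using homog_add[of k f "- g"] homog_minus[of k g] by simp

lemma homog_mult: assumes "homog k f" "homog l g" "n = k + l" shows "homog n (f * g)"
  unfolding homog_def
proof
  fix m assume "m \<in> Poly_Mapping.keys (f * g)"
  then obtain a b where "a \<in> Poly_Mapping.keys f" "b \<in> Poly_Mapping.keys g" "m = a + b"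
    using keys_mult[of f g] by blast
  then show "mon_deg m = n"
    using assms by (auto simp: homog_def mon_deg_add)
qed

lemma homog_sum: "(\<And>i. i \<in> I \<Longrightarrow> homog k (f i)) \<Longrightarrow> homog k (sum f I)"
  by (induction I rule: infinite_finite_induct) (auto intro: homog_add)

lemma homog_Const [simp]: "homog 0 (Const r)" by (simp add: homog_def Const_def mon_deg_def)

lemma homog_Var: "homog (var_deg x) (Var x)"
  by (simp add: homog_def Var_def mon_deg_def)

lemma homog_1 [simp]: "homog 0 1" using homog_Const[of 1] by (simp add: Const_def)

lemma homog_numeral [simp]: "homog 0 (numeral n)"
proof -
  have "homog 0 (of_nat k)" for k by (induction k) (auto intro: homog_add)
  from this[of "numeral n"] show ?thesis by simp
qed

lemma homog_power: "homog k f \<Longrightarrow> l = int n * k \<Longrightarrow> homog l (f ^ n)"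
  by (induction n arbitrary: l) (auto intro!: homog_mult simp: algebra_simps)

lemma homog_prod: "finite T \<Longrightarrow> (\<And>t. t \<in> T \<Longrightarrow> homog k (f t)) \<Longrightarrow> l = int (card T) * k \<Longrightarrow> homog l (prod f T)"
  by (induction T arbitrary: l rule: finite_induct) (auto intro!: homog_mult simp: algebra_simps)

text \<open>The conditions of \<open>matrix_factorization\<close> in terms of the coefficients.\<close>

definition mat_mf :: "'e mpoly set \<Rightarrow> int \<Rightarrow> 'e mpoly \<Rightarrow> 'e mf \<Rightarrow> bool" where
  "mat_mf R m W M \<longleftrightarrow> W \<in> R \<and> homog (2 * m) W \<and> finite (mf_gens M) \<and>
    (\<forall>h\<in>mf_gens M. \<forall>g\<in>mf_gens M. mf_coef M h g \<in> R \<and>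
       (mf_odd M h = mf_odd M g \<longrightarrow> mf_coef M h g = 0) \<and>
       homog (m + mf_deg M g - mf_deg M h) (mf_coef M h g) \<and>
       (\<Sum>k\<in>mf_gens M. mf_coef M h k * mf_coef M k g) = (if h = g then W else 0))"

lemma mat_mf_imp:
  assumes M: "mat_mf R m W M" and R: "R = poly_ring X"
  shows "matrix_factorization R m W M"
proof -
  let ?E = "mf_even_gens M" and ?O = "mf_odd_gens M"
  have fin: "finite (mf_gens M)" "finite ?E" "finite ?O"
    using M by (auto simp: mat_mf_def mf_even_gens_def mf_odd_gens_def)
  have sub: "g \<in> ?E \<or> g \<in> ?O \<Longrightarrow> g \<in> mf_gens M" for g
    by (auto simp: mf_even_gens_def mf_odd_gens_def)
  have cR: "h \<in> mf_gens M \<Longrightarrow> g \<in> mf_gens M \<Longrightarrow> mf_coef M h g \<in> R" for h g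
    using M by (auto simp: mat_mf_def)
  have cH: "h \<in> mf_gens M \<Longrightarrow> g \<in> mf_gens M \<Longrightarrow> homog (m + mf_deg M g - mf_deg M h) (mf_coef M h g)" for h g
    using M by (auto simp: mat_mf_def)
  have sq: "h \<in> mf_gens M \<Longrightarrow> g \<in> mf_gens M \<Longrightarrow> (\<Sum>k\<in>mf_gens M. mf_coef M h k * mf_coef M k g) = (if h = g then W else 0)" for h g
    using M by (auto simp: mat_mf_def)
  have par: "h \<in> mf_gens M \<Longrightarrow> g \<in> mf_gens M \<Longrightarrow> mf_odd M h = mf_odd M g \<Longrightarrow> mf_coef M h g = 0" for h g
    using M by (auto simp: mat_mf_def)
  have sqE: "(\<Sum>k\<in>?O. mf_coef M h k * mf_coef M k g) = (if h = g then W else 0)" if "h \<in> ?E" "g \<in> ?E" for h g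
  proof -
    have "(\<Sum>k\<in>?O. mf_coef M h k * mf_coef M k g) = (\<Sum>k\<in>mf_gens M. mf_coef M h k * mf_coef M k g)"
      using that fin by (intro sum.mono_neutral_left) (auto simp: mf_odd_gens_def mf_even_gens_def par)
    with sq that sub show ?thesis by auto
  qed
  have sqO: "(\<Sum>k\<in>?E. mf_coef M h k * mf_coef M k g) = (if h = g then W else 0)" if "h \<in> ?O" "g \<in> ?O" for h g
  proof -
    have "(\<Sum>k\<in>?E. mf_coef M h k * mf_coef M k g) = (\<Sum>k\<in>mf_gens M. mf_coef M h k * mf_coef M k g)"
      using that fin by (intro sum.mono_neutral_left) (auto simp: mf_odd_gens_def mf_even_gens_def par)
    with sq that sub show ?thesis by auto
  qed
  have dd: "(\<Sum>g\<in>B. mf_coef M h g * (\<Sum>k\<in>A. mf_coef M g k * u k)) = W * u h"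
    if "finite A" "h \<in> A" and s: "\<And>k. k \<in> A \<Longrightarrow> (\<Sum>g\<in>B. mf_coef M h g * mf_coef M g k) = (if h = k then W else 0)"
    for A B h u
  proof -
    have "(\<Sum>g\<in>B. mf_coef M h g * (\<Sum>k\<in>A. mf_coef M g k * u k)) = (\<Sum>k\<in>A. (\<Sum>g\<in>B. mf_coef M h g * mf_coef M g k) * u k)"
      unfolding sum_distrib_left sum_distrib_right by (subst sum.swap) (simp add: mult.assoc)
    also have "\<dots> = (\<Sum>k\<in>A. if h = k then W * u k else 0)"
      using s by (intro sum.cong) auto
    also have "\<dots> = W * u h" using that by simp
    finally show ?thesis .
  qed
  have lin0: "linear_map R (mf_module0 R M) (mf_module1 R M) (mf_d0 M)"
    unfolding linear_map_def
    by (auto simp: free_module_def mf_d0_def R sub distrib_left sum.distrib mult.left_commute sum_distrib_left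
        intro!: poly_ring_closed cR[unfolded R] ext)
  have lin1: "linear_map R (mf_module1 R M) (mf_module0 R M) (mf_d1 M)"
    unfolding linear_map_def
    by (auto simp: free_module_def mf_d1_def R sub distrib_left sum.distrib mult.left_commute sum_distrib_left
        intro!: poly_ring_closed cR[unfolded R] ext)
  have gr0: "graded_map M M m (mf_module0 R M) (mf_d0 M)"
    unfolding graded_map_def mf_homog_def mf_d0_def
    by (auto intro!: homog_sum homog_mult[OF cH] simp: sub)
  have gr1: "graded_map M M m (mf_module1 R M) (mf_d1 M)"
    unfolding graded_map_def mf_homog_def mf_d1_def
    by (auto intro!: homog_sum homog_mult[OF cH] simp: sub)
  have "mf_d1 M (mf_d0 M u) = (\<lambda>g. W * u g)" if "u \<in> mf_module0 R M" for u
    using that by (auto simp: mf_d1_def mf_d0_def free_module_def fin intro!: ext dd sqE)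
  moreover have "mf_d0 M (mf_d1 M u) = (\<lambda>g. W * u g)" if "u \<in> mf_module1 R M" for u
    using that by (auto simp: mf_d1_def mf_d0_def free_module_def fin intro!: ext dd sqO)
  ultimately show ?thesis
    using lin0 lin1 gr0 gr1 M unfolding matrix_factorization_def mat_mf_def by auto
qed

lemma mat_mf_unit: "R = poly_ring X \<Longrightarrow> mat_mf R m 0 mf_unit"
  by (auto simp: mat_mf_def mf_unit_def)

lemma mat_mf_elem:
  assumes "R = poly_ring X" "A \<in> R" "B \<in> R" "homog dA A" "homog dB B" "even (dB - dA)" "dA + dB = 2 * m"
  shows "mat_mf R m (A * B) (elem_mf A dA B dB)"
proof -
  obtain j where j: "dB - dA = 2 * j" using assms by blast
  have "m - j = dA" "m + j = dB" using j assms by auto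
  with j assms show ?thesis
    by (auto simp: mat_mf_def elem_mf_def mult.commute intro!: poly_ring_closed homog_mult)
qed

lemma mat_mf_shift_q: "mat_mf R m W M \<Longrightarrow> mat_mf R m W (shift_q j M)"
  by (simp add: mat_mf_def shift_q_def add_diff_eq)

lemma mat_mf_shift_1: "R = poly_ring X \<Longrightarrow> mat_mf R m W M \<Longrightarrow> mat_mf R m W (shift_1 M)"
  by (auto simp: mat_mf_def shift_1_def intro!: poly_ring_closed homog_minus)

lemma mat_mf_tensor:
  assumes R: "R = poly_ring X" and M: "mat_mf R m W M" and N: "mat_mf R m V N"
  shows "mat_mf R m (W + V) (mf_tensor M N)"
proof -
  have fin: "finite (mf_gens M)" "finite (mf_gens N)" using M N by (auto simp: mat_mf_def)
  have sqM: "h \<in> mf_gens M \<Longrightarrow> g \<in> mf_gens M \<Longrightarrow> (\<Sum>k\<in>mf_gens M. mf_coef M h k * mf_coef M k g) = (if h = g then W else 0)" for h g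
    using M by (auto simp: mat_mf_def)
  have sqN: "h \<in> mf_gens N \<Longrightarrow> g \<in> mf_gens N \<Longrightarrow> (\<Sum>k\<in>mf_gens N. mf_coef N h k * mf_coef N k g) = (if h = g then V else 0)" for h g
    using N by (auto simp: mat_mf_def)
  have parM: "h \<in> mf_gens M \<Longrightarrow> g \<in> mf_gens M \<Longrightarrow> mf_odd M h = mf_odd M g \<Longrightarrow> mf_coef M h g = 0" for h g
    using M by (auto simp: mat_mf_def)
  have sq: "(\<Sum>k\<in>mf_gens (mf_tensor M N). mf_coef (mf_tensor M N) (Tensor_gen h h') k * mf_coef (mf_tensor M N) k (Tensor_gen g g'))
      = (if h = g \<and> h' = g' then W + V else 0)"
    if i: "h \<in> mf_gens M" "h' \<in> mf_gens N" "g \<in> mf_gens M" "g' \<in> mf_gens N" for h h' g g'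
  proof -
    let ?s = "\<lambda>g. if mf_odd M g then -1 else (1 :: 'a mpoly)"
    let ?a = "mf_coef M" and ?b = "mf_coef N"
    let ?\<delta> = "\<lambda>x y. if x = (y :: gen) then (1 :: 'a mpoly) else 0"
    have "(\<Sum>k\<in>mf_gens (mf_tensor M N). mf_coef (mf_tensor M N) (Tensor_gen h h') k * mf_coef (mf_tensor M N) k (Tensor_gen g g'))
      = (\<Sum>(k,k')\<in>mf_gens M \<times> mf_gens N. mf_coef (mf_tensor M N) (Tensor_gen h h') (Tensor_gen k k') * mf_coef (mf_tensor M N) (Tensor_gen k k') (Tensor_gen g g'))"
      unfolding mf_tensor_def mf.simps
      by (subst sum.reindex) (auto simp: inj_on_def split_def)
    also have "\<dots> = (\<Sum>k\<in>mf_gens M. \<Sum>k'\<in>mf_gens N.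
        (?a h k * ?\<delta> h' k' + ?\<delta> h k * ?s k * ?b h' k') * (?a k g * ?\<delta> k' g' + ?\<delta> k g * ?s g * ?b k' g'))"
      unfolding sum.cartesian_product[symmetric]
      by (intro sum.cong) (auto simp: mf_tensor_def)
    also have "\<dots> = (\<Sum>k\<in>mf_gens M. \<Sum>k'\<in>mf_gens N. (?a h k * ?a k g) * ?\<delta> h' k' * ?\<delta> k' g')
        + (\<Sum>k\<in>mf_gens M. \<Sum>k'\<in>mf_gens N. ?a h k * ?\<delta> k g * ?s g * ?\<delta> h' k' * ?b k' g')
        + (\<Sum>k\<in>mf_gens M. \<Sum>k'\<in>mf_gens N. ?\<delta> h k * ?s k * ?a k g * ?b h' k' * ?\<delta> k' g')
        + (\<Sum>k\<in>mf_gens M. \<Sum>k'\<in>mf_gens N. ?\<delta> h k * ?s k * ?\<delta> k g * ?s g * (?b h' k' * ?b k' g'))"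
      by (simp only: distrib_left distrib_right sum.distrib mult_ac add_ac)
    also have "(\<Sum>k\<in>mf_gens M. \<Sum>k'\<in>mf_gens N. (?a h k * ?a k g) * ?\<delta> h' k' * ?\<delta> k' g')
        = (if h = g \<and> h' = g' then W else 0)"
    proof -
      have "(\<Sum>k'\<in>mf_gens N. z * ?\<delta> h' k' * ?\<delta> k' g') = z * ?\<delta> h' g'" for z
      proof -
        have "(\<Sum>k'\<in>mf_gens N. z * ?\<delta> h' k' * ?\<delta> k' g') = (\<Sum>k'\<in>mf_gens N. if h' = k' then z * ?\<delta> k' g' else 0)"
          by (intro sum.cong) auto
        then show ?thesis using fin i by simp
      qed
      then have "(\<Sum>k\<in>mf_gens M. \<Sum>k'\<in>mf_gens N. (?a h k * ?a k g) * ?\<delta> h' k' * ?\<delta> k' g') = (\<Sum>k\<in>mf_gens M. ?a h k * ?a k g) * ?\<delta> h' g'"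
        by (simp add: sum_distrib_right)
      then show ?thesis using sqM i by auto
    qed
    also have "(\<Sum>k\<in>mf_gens M. \<Sum>k'\<in>mf_gens N. ?\<delta> h k * ?s k * ?\<delta> k g * ?s g * (?b h' k' * ?b k' g'))
        = (if h = g \<and> h' = g' then V else 0)"
    proof -
      have "(\<Sum>k\<in>mf_gens M. \<Sum>k'\<in>mf_gens N. ?\<delta> h k * ?s k * ?\<delta> k g * ?s g * (?b h' k' * ?b k' g'))
        = (\<Sum>k\<in>mf_gens M. ?\<delta> h k * ?s k * ?\<delta> k g * ?s g) * (if h' = g' then V else 0)"
        unfolding sum_distrib_right using sqN i by (intro sum.cong) (simp_all add: sum_distrib_left[symmetric])
      also have "(\<Sum>k\<in>mf_gens M. ?\<delta> h k * ?s k * ?\<delta> k g * ?s g) = (\<Sum>k\<in>mf_gens M. if h = k then ?\<delta> k g else 0)"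
        by (intro sum.cong) auto
      also have "\<dots> = ?\<delta> h g" using fin i by simp
      finally show ?thesis by simp
    qed
    also have "(\<Sum>k\<in>mf_gens M. \<Sum>k'\<in>mf_gens N. ?a h k * ?\<delta> k g * ?s g * ?\<delta> h' k' * ?b k' g') = ?a h g * ?s g * ?b h' g'"
    proof -
      have "(\<Sum>k'\<in>mf_gens N. z * ?\<delta> h' k' * ?b k' g') = z * ?b h' g'" for z
      proof -
        have "(\<Sum>k'\<in>mf_gens N. z * ?\<delta> h' k' * ?b k' g') = (\<Sum>k'\<in>mf_gens N. if h' = k' then z * ?b k' g' else 0)"
          by (intro sum.cong) auto
        then show ?thesis using fin i by simp
      qed
      then have "(\<Sum>k\<in>mf_gens M. \<Sum>k'\<in>mf_gens N. ?a h k * ?\<delta> k g * ?s g * ?\<delta> h' k' * ?b k' g') = (\<Sum>k\<in>mf_gens M. ?a h k * ?\<delta> k g * ?s g * ?b h' g')"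
        by simp
      also have "\<dots> = (\<Sum>k\<in>mf_gens M. if k = g then ?a h k * ?s g * ?b h' g' else 0)"
        by (intro sum.cong) auto
      finally show ?thesis using fin i by simp
    qed
    also have "(\<Sum>k\<in>mf_gens M. \<Sum>k'\<in>mf_gens N. ?\<delta> h k * ?s k * ?a k g * ?b h' k' * ?\<delta> k' g') = ?a h g * ?s h * ?b h' g'"
    proof -
      have "(\<Sum>k'\<in>mf_gens N. z * ?b h' k' * ?\<delta> k' g') = z * ?b h' g'" for z
      proof -
        have "(\<Sum>k'\<in>mf_gens N. z * ?b h' k' * ?\<delta> k' g') = (\<Sum>k'\<in>mf_gens N. if k' = g' then z * ?b h' k' else 0)"
          by (intro sum.cong) auto
        then show ?thesis using fin i by simp
      qed
      then have "(\<Sum>k\<in>mf_gens M. \<Sum>k'\<in>mf_gens N. ?\<delta> h k * ?s k * ?a k g * ?b h' k' * ?\<delta> k' g') = (\<Sum>k\<in>mf_gens M. ?\<delta> h k * ?s k * ?a k g * ?b h' g')"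
        by simp
      also have "\<dots> = (\<Sum>k\<in>mf_gens M. if h = k then ?a k g * ?s k * ?b h' g' else 0)"
        by (intro sum.cong) auto
      finally show ?thesis using fin i by simp
    qed
    finally show ?thesis using parM[of h g] i by auto
  qed
  have "W + V \<in> R" "homog (2 * m) (W + V)"
    using M N by (auto simp: mat_mf_def R intro!: poly_ring_closed homog_add)
  moreover have "finite (mf_gens (mf_tensor M N))" using fin by (simp add: mf_tensor_def)
  moreover have "mf_coef (mf_tensor M N) h g \<in> R \<and>
       (mf_odd (mf_tensor M N) h = mf_odd (mf_tensor M N) g \<longrightarrow> mf_coef (mf_tensor M N) h g = 0) \<and>
       homog (m + mf_deg (mf_tensor M N) g - mf_deg (mf_tensor M N) h) (mf_coef (mf_tensor M N) h g)"
    if hg: "h \<in> mf_gens (mf_tensor M N)" "g \<in> mf_gens (mf_tensor M N)" for h g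
  proof -
    obtain h1 h2 g1 g2 where i: "h = Tensor_gen h1 h2" "g = Tensor_gen g1 g2"
      "h1 \<in> mf_gens M" "h2 \<in> mf_gens N" "g1 \<in> mf_gens M" "g2 \<in> mf_gens N"
      using hg by (auto simp: mf_tensor_def)
    have a: "mf_coef M h1 g1 \<in> R" "mf_odd M h1 = mf_odd M g1 \<longrightarrow> mf_coef M h1 g1 = 0"
      "homog (m + mf_deg M g1 - mf_deg M h1) (mf_coef M h1 g1)"
      "mf_coef N h2 g2 \<in> R" "mf_odd N h2 = mf_odd N g2 \<longrightarrow> mf_coef N h2 g2 = 0"
      "homog (m + mf_deg N g2 - mf_deg N h2) (mf_coef N h2 g2)"
      using M N i by (auto simp: mat_mf_def)
    have z: "mf_coef M h1 h1 = 0" "mf_coef N h2 h2 = 0" using M N i by (auto simp: mat_mf_def)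
    show ?thesis
    proof (cases "h1 = g1"; cases "h2 = g2")
      assume "h1 \<noteq> g1" "h2 = g2" then show ?thesis using a z
        by (auto simp: i mf_tensor_def R add_diff_eq)
    next
      assume "h1 = g1" "h2 \<noteq> g2" then show ?thesis using a z
        by (auto simp: i mf_tensor_def R add_diff_eq intro!: poly_ring_closed homog_minus)
    qed (use z in \<open>auto simp: i mf_tensor_def R\<close>)
  qed
  ultimately show ?thesis
    unfolding mat_mf_def using sq by (auto simp: mf_tensor_def)
qed

lemma mat_mf_tensor_list:
  assumes R: "R = poly_ring X" and "list_all2 (mat_mf R m) Ws Ms"
  shows "mat_mf R m (sum_list Ws) (mf_tensor_list Ms)"
  using assms(2)
  by (induction rule: list_all2_induct)
     (auto simp: mf_tensor_list_def intro: mat_mf_unit[OF R] mat_mf_tensor[OF R])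

lemma pow_quot_ring: "x \<in> poly_ring X \<Longrightarrow> y \<in> poly_ring X \<Longrightarrow> pow_quot n x y \<in> poly_ring X"
  by (auto simp: pow_quot_def intro!: poly_ring_closed)

lemma pow_quot_homog: "homog 2 x \<Longrightarrow> homog 2 y \<Longrightarrow> k = 2 * int n - 2 \<Longrightarrow> homog k (pow_quot n x y)"
  by (auto simp: pow_quot_def intro!: homog_sum homog_mult[OF homog_power[OF _ refl] homog_power[OF _ refl]])

lemma homog_params: "homog 2 (Var Par_a)" "homog 4 (Var Par_b)" "homog 6 (Var Par_c)" "homog 2 (Var (Mark e i))"
  using homog_Var[of Par_a] homog_Var[of Par_b] homog_Var[of Par_c] homog_Var[of "Mark e i"] by auto

lemma mat_mf_arc:
  assumes "Mark e i \<in> X" "Mark e' j \<in> X" "{Par_a, Par_b, Par_c} \<subseteq> X"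
  shows "mat_mf (poly_ring X) 4 (p_pol (Var (Mark e i)) - p_pol (Var (Mark e' j))) (arc_mf ((e', j), (e, i)))"
  unfolding arc_mf_def p_quot[symmetric] Let_def split
  using assms
  by (intro mat_mf_elem[OF refl])
     (auto simp: p_quot_def intro!: poly_ring_closed pow_quot_ring homog_diff homog_params
        homog_mult[OF homog_Const homog_params(1)] pow_quot_homog homog_mult[OF homog_numeral homog_params(2)]
        homog_mult[OF homog_numeral homog_params(3)]
        homog_mult[OF homog_mult[OF homog_Const homog_params(1) refl] pow_quot_homog[OF _ _ refl]]
        homog_mult[OF homog_mult[OF homog_numeral homog_params(2) refl] pow_quot_homog[OF _ _ refl]])

text \<open>\<open>p(x) + p(y) + p(z)\<close> in terms of the elementary symmetric polynomials of \<open>x, y, z\<close>.\<close>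

definition P_sym :: "(nat \<Rightarrow> 'e mpoly) \<Rightarrow> 'e mpoly" where
  "P_sym e = e 1 ^ 4 - 4 * e 1 ^ 2 * e 2 + 2 * e 2 ^ 2 + 4 * e 1 * e 3
     - Const (4/3) * Var Par_a * (e 1 ^ 3 - 3 * e 1 * e 2 + 3 * e 3)
     - 2 * Var Par_b * (e 1 ^ 2 - 2 * e 2) - 4 * Var Par_c * e 1"

lemma Const_third: "Var Par_a = 3 * (Const (1/3) * Var Par_a :: 'a mpoly)" "Const (4/3) * Var Par_a = 4 * (Const (1/3) * Var Par_a :: 'a mpoly)"
proof -
  have n: "(numeral k :: 'a mpoly) = Const (numeral k)" for k
    by (simp add: Const_def)
  have m: "Const q * Const r = (Const (q * r) :: 'a mpoly)" for q r
    by (simp add: Const_def mult_single)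
  have "3 * Const (1/3) = (1 :: 'a mpoly)" "4 * Const (1/3) = (Const (4/3) :: 'a mpoly)"
    unfolding n m by (simp_all add: Const_def)
  then show "Var Par_a = 3 * (Const (1/3) * Var Par_a :: 'a mpoly)" "Const (4/3) * Var Par_a = 4 * (Const (1/3) * Var Par_a :: 'a mpoly)"
    unfolding mult.assoc[symmetric] by simp_all
qed

lemma pair_aux:
  fixes e1 :: "'a :: comm_ring_1"
  assumes "q4 * (e1 - v1) = e1 ^ 4 - v1 ^ 4" "q3 * (e1 - v1) = e1 ^ 3 - v1 ^ 3"
  shows "(q4 - 4 * e2 * (e1 + v1) + 4 * e3 - 4 * t * (q3 - 3 * e2) - 2 * b * (e1 + v1) - 4 * c) * (e1 - v1)
   + (2 * (e2 + v2) - 4 * v1 ^ 2 + 4 * (3 * t) * v1 + 4 * b) * (e2 - v2)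
   + 4 * (v1 - 3 * t) * (e3 - v3)
   = (e1 ^ 4 - 4 * e1 ^ 2 * e2 + 2 * e2 ^ 2 + 4 * e1 * e3 - 4 * t * (e1 ^ 3 - 3 * e1 * e2 + 3 * e3) - 2 * b * (e1 ^ 2 - 2 * e2) - 4 * c * e1)
   - (v1 ^ 4 - 4 * v1 ^ 2 * v2 + 2 * v2 ^ 2 + 4 * v1 * v3 - 4 * t * (v1 ^ 3 - 3 * v1 * v2 + 3 * v3) - 2 * b * (v1 ^ 2 - 2 * v2) - 4 * c * v1)"
proof -
  have "(q4 - 4 * e2 * (e1 + v1) + 4 * e3 - 4 * t * (q3 - 3 * e2) - 2 * b * (e1 + v1) - 4 * c) * (e1 - v1)
     = (q4 * (e1 - v1)) - 4 * t * (q3 * (e1 - v1)) + (- 4 * e2 * (e1 + v1) + 4 * e3 + 12 * t * e2 - 2 * b * (e1 + v1) - 4 * c) * (e1 - v1)"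
    by (simp add: algebra_simps)
  then show ?thesis unfolding assms by (simp add: algebra_simps power2_eq_square)
qed

lemma pair_potential:
  fixes e s :: "nat \<Rightarrow> 'e mpoly"
  shows "g1_pol e s * (e 1 - s 1) + g2_pol e s * (e 2 - s 2) + g3_pol e s * (e 3 - s 3) = P_sym e - P_sym s"
proof -
  define t where "t = Const (1/3) * Var (Par_a :: 'e var)"
  have t: "Const (4/3) * Var Par_a = 4 * t" and t': "Var Par_a = 3 * t"
    unfolding t_def by (rule Const_third)+
  show ?thesis
    unfolding g1_pol_def g2_pol_def g3_pol_def P_sym_def t unfolding t'
    by (rule pair_aux) (rule pow_quot)+
qed

lemma mat_mf_pair:
  assumes "\<And>i. i \<in> {1,2,3} \<Longrightarrow> e i \<in> poly_ring X \<and> homog (2 * int i) (e i)"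
    "\<And>i. i \<in> {1,2,3} \<Longrightarrow> s i \<in> poly_ring X \<and> homog (2 * int i) (s i)" "{Par_a, Par_b, Par_c} \<subseteq> X"
  shows "mat_mf (poly_ring X) 4 (P_sym e - P_sym s) (pair_mf e s)"
proof -
  have r: "e 1 \<in> poly_ring X" "e 2 \<in> poly_ring X" "e 3 \<in> poly_ring X"
    "s 1 \<in> poly_ring X" "s 2 \<in> poly_ring X" "s 3 \<in> poly_ring X"
    "e (Suc 0) \<in> poly_ring X" "s (Suc 0) \<in> poly_ring X"
    "Var Par_a \<in> poly_ring X" "Var Par_b \<in> poly_ring X" "Var Par_c \<in> poly_ring X"
    using assms(1)[of 1] assms(1)[of 2] assms(1)[of 3] assms(2)[of 1] assms(2)[of 2] assms(2)[of 3] assms(3) by auto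
  have h: "homog 2 (e 1)" "homog 4 (e 2)" "homog 6 (e 3)" "homog 2 (s 1)" "homog 4 (s 2)" "homog 6 (s 3)"
    using assms(1)[of 1] assms(1)[of 2] assms(1)[of 3] assms(2)[of 1] assms(2)[of 2] assms(2)[of 3] by auto
  have n: "homog k x \<Longrightarrow> homog k (numeral n * x)" for k n and x :: "'a mpoly"
    by (rule homog_mult[OF homog_numeral]) auto
  have t: "homog k x \<Longrightarrow> homog k (Const q * x)" for k q and x :: "'a mpoly"
    by (rule homog_mult[OF homog_Const]) auto
  have h': "homog 4 (e 1 ^ 2)" "homog 4 (s 1 ^ 2)" "homog 6 (pow_quot 4 (e 1) (s 1))" "homog 4 (pow_quot 3 (e 1) (s 1))"
    using h by (auto intro!: homog_power pow_quot_homog)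
  note m = homog_mult
  have G1: "homog 6 (g1_pol e s)"
    unfolding g1_pol_def mult.assoc
    by (intro homog_add homog_diff n t h h' homog_params m[OF h(2) _, of 2] m[OF homog_params(1), of 4] m[OF homog_params(2), of 2]) auto
  have G2: "homog 4 (g2_pol e s)"
    unfolding g2_pol_def mult.assoc
    by (intro homog_add homog_diff n t h h' homog_params m[OF homog_params(1), of 2]) auto
  have G3: "homog 2 (g3_pol e s)"
    unfolding g3_pol_def by (intro homog_diff n h homog_params)
  have R: "g1_pol e s \<in> poly_ring X" "g2_pol e s \<in> poly_ring X" "g3_pol e s \<in> poly_ring X"
    unfolding g1_pol_def g2_pol_def g3_pol_def
    by (auto intro!: poly_ring_closed pow_quot_ring r)
  have "mat_mf (poly_ring X) 4 (sum_list [g1_pol e s * (e 1 - s 1), g2_pol e s * (e 2 - s 2), g3_pol e s * (e 3 - s 3)])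
     (mf_tensor_list [elem_mf (g1_pol e s) 6 (e 1 - s 1) 2, elem_mf (g2_pol e s) 4 (e 2 - s 2) 4, elem_mf (g3_pol e s) 2 (e 3 - s 3) 6])"
    by (intro mat_mf_tensor_list[OF refl] list_all2_Cons[THEN iffD2] conjI list_all2_Nil[THEN iffD2] TrueI mat_mf_elem[OF refl] G1 G2 G3 R poly_ring_closed r homog_diff h) auto
  then show ?thesis
    unfolding pair_mf_def using pair_potential[of e s]
    by (auto intro!: mat_mf_shift_1[OF refl] mat_mf_shift_q simp: add.assoc)
qed

lemma esym_aux: fixes a b c :: "'a :: comm_ring_1"
  shows "(a+b+c)^4 - 4 * (a+b+c)\<^sup>2 * (a * b + a * c + b * c) + 2 * (a * b + a * c + b * c)\<^sup>2 + 4 * (a+b+c) * (a * b * c)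
   - t * p * ((a+b+c)^3 - 3 * (a+b+c) * (a * b + a * c + b * c) + 3 * (a * b * c))
   - 2 * q * ((a+b+c)\<^sup>2 - 2 * (a * b + a * c + b * c)) - 4 * r * (a+b+c) =
   a ^ 4 - t * p * a ^ 3 - 2 * q * a\<^sup>2 - 4 * r * a + (b ^ 4 - t * p * b ^ 3 - 2 * q * b\<^sup>2 - 4 * r * b) + (c ^ 4 - t * p * c ^ 3 - 2 * q * c\<^sup>2 - 4 * r * c)"
  by (simp add: algebra_simps power2_eq_square power3_eq_cube power4_eq_xxxx)

lemma esym_3:
  assumes "card S = 3"
  shows "P_sym (esym x S) = (\<Sum>e\<in>S. p_pol (x e))"
proof -
  from assms obtain a b c where S: "S = {a, b, c}" "a \<noteq> b" "a \<noteq> c" "b \<noteq> c"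
    by (auto simp: card_Suc_eq numeral_eq_Suc)
  have 1: "{T. T \<subseteq> S \<and> card T = 1} = {{a},{b},{c}}"
    using S by (auto simp: card_1_singleton_iff)
  have 2: "{T. T \<subseteq> S \<and> card T = 2} = {{a,b},{a,c},{b,c}}"
    using S by (auto simp: card_2_iff)
  have 3: "{T. T \<subseteq> S \<and> card T = 3} = {S}"
  proof (intro equalityI subsetI)
    fix T assume "T \<in> {T. T \<subseteq> S \<and> card T = 3}"
    then have "T \<subseteq> S" "card T = card S" using assms by auto
    moreover have "finite S" using S by simp
    ultimately show "T \<in> {S}" using card_subset_eq[of S T] by simp
  qed (use assms in auto)
  have e: "esym x S 1 = x a + x b + x c" "esym x S 2 = x a * x b + x a * x c + x b * x c"
    "esym x S 3 = x a * x b * x c"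
    unfolding esym_def 1 2 3 using S by (auto simp: doubleton_eq_iff)
  have s: "(\<Sum>e\<in>S. p_pol (x e)) = p_pol (x a) + p_pol (x b) + p_pol (x c)"
    using S by simp
  show ?thesis unfolding P_sym_def e s unfolding p_pol_def by (rule esym_aux)
qed

lemma esym_ok:
  assumes "finite S" "\<And>e. e \<in> S \<Longrightarrow> f e \<in> poly_ring X \<and> homog 2 (f e)"
  shows "esym f S k \<in> poly_ring X \<and> homog (2 * int k) (esym f S k)"
  unfolding esym_def using assms
  by (auto intro!: poly_ring_closed homog_sum homog_prod[where k=2] dest: finite_subset)

lemma sum_list_distinct: "distinct xs \<Longrightarrow> sum_list (map f xs) = sum f (set xs)"
  by (simp add: sum_list_distinct_conv_sum_set)

theorem identified_mf_matrix_factorization: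
  assumes cw: "closed_web \<Gamma>" and z: "complete_identification \<Gamma> \<zeta>"
    and as: "distinct as" "set as = arcs \<Gamma>" and vs: "distinct vs" "set vs = plus_verts \<Gamma>"
  shows "matrix_factorization (web_ring \<Gamma>) 4 0 (identified_mf \<Gamma> as vs \<zeta>)"
proof -
  define X where "X = ({Par_a, Par_b, Par_c} \<union>
                           {Mark e i |e i. e \<in> edges \<Gamma> \<union> circles \<Gamma> \<and> i < marks \<Gamma> e})"
  have R: "web_ring \<Gamma> = poly_ring X" by (simp add: web_ring_def X_def)
  let ?p = "\<lambda>e i. p_pol (Var (Mark e i))"
  let ?WA = "\<lambda>((e,i),(e',j)). ?p e' j - ?p e i"
  let ?WV = "\<lambda>v. P_sym (out_esym \<Gamma> v) - P_sym (in_esym \<Gamma> (\<zeta> v))"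
  have fin: "finite (edges \<Gamma>)" "finite (circles \<Gamma>)" "finite (verts \<Gamma>)" and dj: "edges \<Gamma> \<inter> circles \<Gamma> = {}"
    and mk: "\<And>e. e \<in> edges \<Gamma> \<union> circles \<Gamma> \<Longrightarrow> marks \<Gamma> e \<ge> 1"
    using cw unfolding closed_web_def is_web_def by blast+
  have A: "mat_mf (poly_ring X) 4 (?WA x) (arc_mf x)" if "x \<in> arcs \<Gamma>" for x
    using that unfolding arcs_def
    by (auto intro!: mat_mf_arc simp: X_def)
  have V: "mat_mf (poly_ring X) 4 (?WV v) (pair_mf (out_esym \<Gamma> v) (in_esym \<Gamma> (\<zeta> v)))" if "v \<in> plus_verts \<Gamma>" for v
  proof (intro mat_mf_pair)
    show "out_esym \<Gamma> v i \<in> poly_ring X \<and> homog (2 * int i) (out_esym \<Gamma> v i)" for i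
      unfolding out_esym_def using fin mk
      by (intro esym_ok) (fastforce simp: out_edges_def X_def intro: homog_params)+
    show "in_esym \<Gamma> (\<zeta> v) i \<in> poly_ring X \<and> homog (2 * int i) (in_esym \<Gamma> (\<zeta> v) i)" for i
      unfolding in_esym_def using fin mk
      by (intro esym_ok) (fastforce simp: in_edges_def X_def intro: homog_params)+
  qed (auto simp: X_def)
  have main: "mat_mf (poly_ring X) 4 (sum_list (map ?WA as @ map ?WV vs)) (identified_mf \<Gamma> as vs \<zeta>)"
    unfolding identified_mf_def
    by (intro mat_mf_tensor_list[OF refl] list_all2_appendI)
       (use as vs in \<open>auto simp: list_all2_conv_all_nth simp del: split_paired_All intro!: A V\<close>)
  have "sum_list (map ?WA as @ map ?WV vs) = sum ?WA (arcs \<Gamma>) + sum ?WV (plus_verts \<Gamma>)"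
    using as vs by (simp add: sum_list_distinct)
  also have "sum ?WA (arcs \<Gamma>) = (\<Sum>e\<in>edges \<Gamma>. ?p e (marks \<Gamma> e - 1) - ?p e 0)"
  proof -
    let ?I = "(\<lambda>(e, i). ((e, i), (e, Suc i))) ` (SIGMA e:edges \<Gamma>. {i. Suc i < marks \<Gamma> e})"
    let ?C = "(\<lambda>(e, i). ((e, i), (e, Suc i mod marks \<Gamma> e))) ` (SIGMA e:circles \<Gamma>. {..<marks \<Gamma> e})"
    have eq: "arcs \<Gamma> = ?I \<union> ?C" unfolding arcs_def by force
    have f: "finite {i. Suc i < n}" for n by (rule finite_subset[of _ "{..<n}"]) auto
    have d: "?I \<inter> ?C = {}" using dj by auto
    have "sum ?WA (arcs \<Gamma>) = sum ?WA ?I + sum ?WA ?C"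
      unfolding eq using fin f d by (intro sum.union_disjoint) auto
    also have "sum ?WA ?I = (\<Sum>e\<in>edges \<Gamma>. \<Sum>i | Suc i < marks \<Gamma> e. ?p e (Suc i) - ?p e i)"
      using fin f by (subst sum.reindex) (auto simp: inj_on_def sum.Sigma split_def)
    also have "\<dots> = (\<Sum>e\<in>edges \<Gamma>. ?p e (marks \<Gamma> e - 1) - ?p e 0)"
    proof (intro sum.cong refl)
      fix e
      have "{i. Suc i < marks \<Gamma> e} = {..<marks \<Gamma> e - 1}" by auto
      then show "(\<Sum>i | Suc i < marks \<Gamma> e. ?p e (Suc i) - ?p e i) = ?p e (marks \<Gamma> e - 1) - ?p e 0"
        by (simp add: sum_lessThan_telescope[of "?p e"])
    qed
    also have "sum ?WA ?C = (\<Sum>e\<in>circles \<Gamma>. \<Sum>i<marks \<Gamma> e. ?p e (Suc i mod marks \<Gamma> e) - ?p e i)"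
      using fin by (subst sum.reindex) (auto simp: inj_on_def sum.Sigma split_def)
    also have "\<dots> = 0"
    proof (rule sum.neutral, rule ballI)
      fix e assume "e \<in> circles \<Gamma>"
      then obtain n where n: "marks \<Gamma> e = Suc n" using mk[of e] by (cases "marks \<Gamma> e") auto
      have "(\<Sum>i<n. ?p e (Suc i mod Suc n)) = (\<Sum>i<n. ?p e (Suc i))"
        by (intro sum.cong) auto
      then show "(\<Sum>i<marks \<Gamma> e. ?p e (Suc i mod marks \<Gamma> e) - ?p e i) = 0"
        unfolding n sum_subtractf sum.lessThan_Suc_shift[of "?p e"]
        using sum.lessThan_Suc[of "\<lambda>i. ?p e (Suc i mod Suc n)" n] by simp
    qed
    finally show ?thesis by simp
  qed
  also have "sum ?WV (plus_verts \<Gamma>) = (\<Sum>v\<in>plus_verts \<Gamma>. P_sym (out_esym \<Gamma> v)) - (\<Sum>v\<in>minus_verts \<Gamma>. P_sym (in_esym \<Gamma> v))"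
    using z sum.reindex_bij_betw[of \<zeta> "plus_verts \<Gamma>" "minus_verts \<Gamma>" "\<lambda>v. P_sym (in_esym \<Gamma> v)"]
    by (simp add: complete_identification_def sum_subtractf)
  also have "(\<Sum>v\<in>plus_verts \<Gamma>. P_sym (out_esym \<Gamma> v)) = (\<Sum>e\<in>edges \<Gamma>. ?p e 0)"
  proof -
    have "(\<Sum>v\<in>plus_verts \<Gamma>. P_sym (out_esym \<Gamma> v)) = (\<Sum>v\<in>plus_verts \<Gamma>. \<Sum>e\<in>out_edges \<Gamma> v. ?p e 0)"
      by (intro sum.cong) (auto simp: out_esym_def plus_verts_def esym_3)
    also have "\<dots> = (\<Sum>e\<in>(\<Union>v\<in>plus_verts \<Gamma>. out_edges \<Gamma> v). ?p e 0)"
      using fin by (intro sum.UNION_disjoint[symmetric]) (auto simp: plus_verts_def out_edges_def)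
    also have "(\<Union>v\<in>plus_verts \<Gamma>. out_edges \<Gamma> v) = edges \<Gamma>"
    proof (intro equalityI subsetI)
      fix e assume e: "e \<in> edges \<Gamma>"
      then obtain v where v: "tail \<Gamma> e = Some v" using cw unfolding closed_web_def by blast
      then have "v \<in> verts \<Gamma>" using cw e unfolding closed_web_def is_web_def by force
      moreover have "e \<in> out_edges \<Gamma> v" using e v by (simp add: out_edges_def)
      ultimately show "e \<in> (\<Union>v\<in>plus_verts \<Gamma>. out_edges \<Gamma> v)"
        using cw unfolding closed_web_def is_web_def minus_verts_def by blast
    qed (auto simp: out_edges_def)
    finally show ?thesis .
  qed
  also have "(\<Sum>v\<in>minus_verts \<Gamma>. P_sym (in_esym \<Gamma> v)) = (\<Sum>e\<in>edges \<Gamma>. ?p e (marks \<Gamma> e - 1))"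
  proof -
    have "(\<Sum>v\<in>minus_verts \<Gamma>. P_sym (in_esym \<Gamma> v)) = (\<Sum>v\<in>minus_verts \<Gamma>. \<Sum>e\<in>in_edges \<Gamma> v. ?p e (marks \<Gamma> e - 1))"
      by (intro sum.cong) (auto simp: in_esym_def minus_verts_def esym_3)
    also have "\<dots> = (\<Sum>e\<in>(\<Union>v\<in>minus_verts \<Gamma>. in_edges \<Gamma> v). ?p e (marks \<Gamma> e - 1))"
      using fin by (intro sum.UNION_disjoint[symmetric]) (auto simp: minus_verts_def in_edges_def)
    also have "(\<Union>v\<in>minus_verts \<Gamma>. in_edges \<Gamma> v) = edges \<Gamma>"
    proof (intro equalityI subsetI)
      fix e assume e: "e \<in> edges \<Gamma>"
      then obtain v where v: "head \<Gamma> e = Some v" using cw unfolding closed_web_def by blast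
      then have "v \<in> verts \<Gamma>" using cw e unfolding closed_web_def is_web_def by force
      moreover have "e \<in> in_edges \<Gamma> v" using e v by (simp add: in_edges_def)
      ultimately show "e \<in> (\<Union>v\<in>minus_verts \<Gamma>. in_edges \<Gamma> v)"
        using cw unfolding closed_web_def is_web_def plus_verts_def by blast
    qed (auto simp: in_edges_def)
    finally show ?thesis .
  qed
  also have "(\<Sum>e\<in>edges \<Gamma>. ?p e (marks \<Gamma> e - 1) - ?p e 0) + ((\<Sum>e\<in>edges \<Gamma>. ?p e 0) - (\<Sum>e\<in>edges \<Gamma>. ?p e (marks \<Gamma> e - 1))) = 0"
    by (simp add: sum_subtractf)
  finally have "sum_list (map ?WA as @ map ?WV vs) = 0" .
  with main show ?thesis unfolding R using mat_mf_imp[OF _ refl] by metis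
qed

end

theory Submission
  imports Defs "HOL-Library.Multiset"
begin

text \<open>
  Any two pairings of the vertices differ by transpositions, so it suffices to exchange the partners of two
  \<open>(+)\<close>-vertices, with symmetric polynomials \<open>e\<close> and \<open>e'\<close>, that are paired with \<open>s\<close> and \<open>s'\<close>. This only
  changes a Koszul matrix with six rows. Let \<open>A\<^sub>i, A\<^sub>i'\<close> be the left entries of the rows of \<open>(e, s)\<close> and
  \<open>(e', s')\<close>. Subtracting the third rows from each other produces the left entry
  \<open>U = A\<^sub>3 - A\<^sub>3' = 4 (s\<^sub>1 - s\<^sub>1')\<close>, a quarter of which, added to the right entries \<open>e\<^sub>1 - s\<^sub>1\<close> and
  subtracted from \<open>e\<^sub>1' - s\<^sub>1'\<close>, gives the entries \<open>e\<^sub>1 - s\<^sub>1'\<close> and \<open>e\<^sub>1' - s\<^sub>1\<close> of the exchanged pairing.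
  The difference \<open>A\<^sub>2 - A\<^sub>2'\<close> is \<open>4 (e\<^sub>2 - s\<^sub>2')\<close> modulo \<open>U\<close> and \<open>e\<^sub>2 + e\<^sub>2' - s\<^sub>2 - s\<^sub>2'\<close>, so in the second row
  the two columns of one pairing are, up to a factor, those of the other pairing in reverse order:
  each transposition shifts the parity by one. Multiples of the other right entries bring the remaining
  right entry into place, after which the left entries agree as well.
\<close>

section \<open>Isomorphisms given by matrices\<close>

definition kron :: "gen \<Rightarrow> gen \<Rightarrow> 'e mpoly" where
  "kron h g = (if h = g then 1 else 0)"

definition mat_mult ::
  "gen set \<Rightarrow> (gen \<Rightarrow> gen \<Rightarrow> 'e mpoly) \<Rightarrow> (gen \<Rightarrow> gen \<Rightarrow> 'e mpoly) \<Rightarrow> gen \<Rightarrow> gen \<Rightarrow> 'e mpoly" where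
  "mat_mult G P Q = (\<lambda>h g. \<Sum>k\<in>G. P h k * Q k g)"

text \<open>Rows belong to generators of the target and columns to those of the source: such a
  matrix is a map of degree 0 that preserves parity.\<close>

definition mat_graded :: "'e var set \<Rightarrow> 'e mf \<Rightarrow> 'e mf \<Rightarrow> (gen \<Rightarrow> gen \<Rightarrow> 'e mpoly) \<Rightarrow> bool" where
  "mat_graded X M N P \<longleftrightarrow> (\<forall>h\<in>mf_gens N. \<forall>g\<in>mf_gens M.
     P h g \<in> poly_ring X \<and> homog (mf_deg M g - mf_deg N h) (P h g) \<and>
     (mf_odd N h \<noteq> mf_odd M g \<longrightarrow> P h g = 0))"

definition mat_chain :: "'e mf \<Rightarrow> 'e mf \<Rightarrow> (gen \<Rightarrow> gen \<Rightarrow> 'e mpoly) \<Rightarrow> bool" where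
  "mat_chain M N P \<longleftrightarrow> (\<forall>h\<in>mf_gens N. \<forall>g\<in>mf_gens M.
     mat_mult (mf_gens M) P (mf_coef M) h g = mat_mult (mf_gens N) (mf_coef N) P h g)"

definition mat_left_inv ::
  "'e mf \<Rightarrow> 'e mf \<Rightarrow> (gen \<Rightarrow> gen \<Rightarrow> 'e mpoly) \<Rightarrow> (gen \<Rightarrow> gen \<Rightarrow> 'e mpoly) \<Rightarrow> bool" where
  "mat_left_inv M N P Q \<longleftrightarrow> (\<forall>h\<in>mf_gens M. \<forall>g\<in>mf_gens M. mat_mult (mf_gens N) Q P h g = kron h g)"

text \<open>That \<open>Q\<close> commutes with the differentials as well follows from
  \<open>mat_chain_inverse\<close>. Finiteness is included because a sum over an infinite set is 0
  by convention.\<close>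

definition mat_iso :: "'e var set \<Rightarrow> 'e mf \<Rightarrow> 'e mf \<Rightarrow> bool" where
  "mat_iso X M N \<longleftrightarrow> finite (mf_gens M) \<and> finite (mf_gens N) \<and>
     (\<exists>P Q. mat_graded X M N P \<and> mat_graded X N M Q \<and> mat_chain M N P \<and>
            mat_left_inv M N P Q \<and> mat_left_inv N M Q P)"

lemma mat_mult_assoc: "mat_mult H (mat_mult G P Q) S h g = mat_mult G P (mat_mult H Q S) h g"
  unfolding mat_mult_def sum_distrib_left sum_distrib_right
  by (subst sum.swap) (simp add: mult.assoc)

lemma mat_mult_cong:
  "(\<And>k. k \<in> G \<Longrightarrow> P h k = P' h k) \<Longrightarrow> (\<And>k. k \<in> G \<Longrightarrow> Q k g = Q' k g) \<Longrightarrow>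
   mat_mult G P Q h g = mat_mult G P' Q' h g"
  unfolding mat_mult_def by (intro sum.cong) auto

lemma mat_mult_kron_left: "finite G \<Longrightarrow> h \<in> G \<Longrightarrow> mat_mult G kron P h g = P h g"
  unfolding mat_mult_def kron_def by (simp add: if_distrib[of "\<lambda>x. x * _"] cong: if_cong)

lemma mat_mult_kron_right: "finite G \<Longrightarrow> g \<in> G \<Longrightarrow> mat_mult G P kron h g = P h g"
  unfolding mat_mult_def kron_def by (simp add: if_distrib[of "\<lambda>x. _ * x"] cong: if_cong)

lemma mat_graded_mult:
  assumes P: "mat_graded X M N P" and Q: "mat_graded X L M Q"
  shows "mat_graded X L N (mat_mult (mf_gens M) P Q)"
  unfolding mat_graded_def mat_mult_def
proof (intro ballI conjI impI)
  fix h g assume hg: "h \<in> mf_gens N" "g \<in> mf_gens L"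
  show "(\<Sum>k\<in>mf_gens M. P h k * Q k g) \<in> poly_ring X"
    using P Q hg by (auto simp: mat_graded_def intro!: poly_ring_closed)
  show "homog (mf_deg L g - mf_deg N h) (\<Sum>k\<in>mf_gens M. P h k * Q k g)"
  proof (intro homog_sum)
    fix k assume "k \<in> mf_gens M"
    then show "homog (mf_deg L g - mf_deg N h) (P h k * Q k g)"
      using P Q hg
      by (intro homog_mult[of "mf_deg M k - mf_deg N h" _ "mf_deg L g - mf_deg M k"])
         (auto simp: mat_graded_def)
  qed
  show "(\<Sum>k\<in>mf_gens M. P h k * Q k g) = 0" if "mf_odd N h \<noteq> mf_odd L g"
  proof (intro sum.neutral ballI)
    fix k assume "k \<in> mf_gens M"
    then show "P h k * Q k g = 0"
      using P Q hg that by (cases "mf_odd M k = mf_odd N h") (auto simp: mat_graded_def)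
  qed
qed

lemma mat_chain_mult:
  assumes P: "mat_chain M N P" and Q: "mat_chain L M Q"
  shows "mat_chain L N (mat_mult (mf_gens M) P Q)"
  unfolding mat_chain_def
proof (intro ballI)
  fix h g assume h: "h \<in> mf_gens N" and g: "g \<in> mf_gens L"
  have "mat_mult (mf_gens L) (mat_mult (mf_gens M) P Q) (mf_coef L) h g
      = mat_mult (mf_gens M) P (mat_mult (mf_gens L) Q (mf_coef L)) h g"
    by (rule mat_mult_assoc)
  also have "\<dots> = mat_mult (mf_gens M) P (mat_mult (mf_gens M) (mf_coef M) Q) h g"
    using Q g by (intro mat_mult_cong) (auto simp: mat_chain_def)
  also have "\<dots> = mat_mult (mf_gens M) (mat_mult (mf_gens M) P (mf_coef M)) Q h g"
    by (rule mat_mult_assoc[symmetric])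
  also have "\<dots> = mat_mult (mf_gens M) (mat_mult (mf_gens N) (mf_coef N) P) Q h g"
    using P h by (intro mat_mult_cong) (auto simp: mat_chain_def)
  also have "\<dots> = mat_mult (mf_gens N) (mf_coef N) (mat_mult (mf_gens M) P Q) h g"
    by (rule mat_mult_assoc)
  finally show "mat_mult (mf_gens L) (mat_mult (mf_gens M) P Q) (mf_coef L) h g
      = mat_mult (mf_gens N) (mf_coef N) (mat_mult (mf_gens M) P Q) h g" .
qed

lemma mat_left_inv_mult:
  assumes fin: "finite (mf_gens M)"
    and 1: "mat_left_inv L M Q Q'" and 2: "mat_left_inv M N P P'"
  shows "mat_left_inv L N (mat_mult (mf_gens M) P Q) (mat_mult (mf_gens M) Q' P')"
  unfolding mat_left_inv_def
proof (intro ballI)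
  fix h g assume h: "h \<in> mf_gens L" and g: "g \<in> mf_gens L"
  have "mat_mult (mf_gens N) (mat_mult (mf_gens M) Q' P') (mat_mult (mf_gens M) P Q) h g
      = mat_mult (mf_gens M) Q' (mat_mult (mf_gens M) (mat_mult (mf_gens N) P' P) Q) h g"
    unfolding mat_mult_assoc by (intro mat_mult_cong) (auto simp: mat_mult_assoc)
  also have "\<dots> = mat_mult (mf_gens M) Q' (mat_mult (mf_gens M) kron Q) h g"
    using 2 by (intro mat_mult_cong refl) (auto simp: mat_left_inv_def)
  also have "\<dots> = mat_mult (mf_gens M) Q' Q h g"
    using fin by (intro mat_mult_cong refl) (auto simp: mat_mult_kron_left)
  also have "\<dots> = kron h g"
    using 1 h g by (auto simp: mat_left_inv_def)
  finally show "mat_mult (mf_gens N) (mat_mult (mf_gens M) Q' P') (mat_mult (mf_gens M) P Q) h g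
    = kron h g" .
qed

text \<open>The computation is \<open>Q n = Q n P Q = Q P m Q = m Q\<close>, with \<open>m\<close>
  and \<open>n\<close> the differentials of \<open>M\<close> and \<open>N\<close>.\<close>

lemma mat_chain_inverse:
  assumes fin: "finite (mf_gens M)" "finite (mf_gens N)" and P: "mat_chain M N P"
    and inv: "mat_left_inv M N P Q" "mat_left_inv N M Q P"
  shows "mat_chain N M Q"
  unfolding mat_chain_def
proof (intro ballI)
  fix h g assume h: "h \<in> mf_gens M" and g: "g \<in> mf_gens N"
  let ?M = "mf_gens M" and ?N = "mf_gens N" and ?m = "mf_coef M" and ?n = "mf_coef N"
  have "mat_mult ?N Q ?n h g = mat_mult ?N Q (mat_mult ?N ?n kron) h g"
    using fin g by (intro mat_mult_cong refl) (auto simp: mat_mult_kron_right)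
  also have "\<dots> = mat_mult ?N Q (mat_mult ?N ?n (mat_mult ?M P Q)) h g"
    using inv g by (intro mat_mult_cong refl) (auto simp: mat_left_inv_def)
  also have "\<dots> = mat_mult ?N Q (mat_mult ?M (mat_mult ?N ?n P) Q) h g"
    by (rule mat_mult_cong[OF refl mat_mult_assoc[symmetric]])
  also have "\<dots> = mat_mult ?N Q (mat_mult ?M (mat_mult ?M P ?m) Q) h g"
    using P by (intro mat_mult_cong refl) (auto simp: mat_chain_def)
  also have "\<dots> = mat_mult ?N Q (mat_mult ?M P (mat_mult ?M ?m Q)) h g"
    by (rule mat_mult_cong[OF refl mat_mult_assoc])
  also have "\<dots> = mat_mult ?M (mat_mult ?N Q P) (mat_mult ?M ?m Q) h g"
    by (rule mat_mult_assoc[symmetric])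
  also have "\<dots> = mat_mult ?M kron (mat_mult ?M ?m Q) h g"
    using inv h by (intro mat_mult_cong refl) (auto simp: mat_left_inv_def)
  also have "\<dots> = mat_mult ?M ?m Q h g"
    using fin h by (simp add: mat_mult_kron_left)
  finally show "mat_mult ?N Q ?n h g = mat_mult ?M ?m Q h g" .
qed

lemma mat_iso_sym: "mat_iso X M N \<Longrightarrow> mat_iso X N M"
  unfolding mat_iso_def using mat_chain_inverse by metis

lemma mat_iso_trans [trans]:
  assumes "mat_iso X L M" "mat_iso X M N"
  shows "mat_iso X L N"
proof -
  from assms(1) obtain Q Q' where Q: "mat_graded X L M Q" "mat_graded X M L Q'" "mat_chain L M Q"
    "mat_left_inv L M Q Q'" "mat_left_inv M L Q' Q"
    unfolding mat_iso_def by blast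
  from assms(2) obtain P P' where P: "mat_graded X M N P" "mat_graded X N M P'" "mat_chain M N P"
    "mat_left_inv M N P P'" "mat_left_inv N M P' P"
    unfolding mat_iso_def by blast
  have fin: "finite (mf_gens L)" "finite (mf_gens M)" "finite (mf_gens N)"
    using assms by (auto simp: mat_iso_def)
  show ?thesis
    unfolding mat_iso_def using P Q fin
    by (intro conjI exI[of _ "mat_mult (mf_gens M) P Q"] exI[of _ "mat_mult (mf_gens M) Q' P'"])
       (auto intro: mat_graded_mult mat_chain_mult mat_left_inv_mult)
qed

section \<open>Rational constants, and isomorphisms by monomial and elementary matrices\<close>

lemma Const_mult: "Const q * Const r = Const (q * r)"
  by (simp add: Const_def mult_single)

lemma Const_1 [simp]: "Const 1 = 1"
  by (simp add: Const_def)

lemma Const_numeral: "Const (numeral k) = numeral k"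
  by (simp add: Const_def)

lemma Const_minus: "Const (- q) = - Const q"
  by (simp add: Const_def single_uminus)

text \<open>A bijection of generators with nonzero rational factors is invertible in degree 0. All
  structural isomorphisms below (symmetry, associativity, unit, shifts, exchange of columns) have
  this form.\<close>

lemma mat_iso_monomial:
  assumes fin: "finite (mf_gens M)" and \<phi>: "bij_betw \<phi> (mf_gens M) (mf_gens N)"
    and c: "\<And>g. g \<in> mf_gens M \<Longrightarrow> c g \<noteq> 0"
    and deg: "\<And>g. g \<in> mf_gens M \<Longrightarrow> mf_deg N (\<phi> g) = mf_deg M g"
    and odd: "\<And>g. g \<in> mf_gens M \<Longrightarrow> mf_odd N (\<phi> g) = mf_odd M g"
    and coef: "\<And>h g. h \<in> mf_gens M \<Longrightarrow> g \<in> mf_gens M \<Longrightarrow>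
      Const (c h) * mf_coef M h g = mf_coef N (\<phi> h) (\<phi> g) * Const (c g)"
  shows "mat_iso X M N"
proof -
  define P where "P h g = (if h = \<phi> g then Const (c g) else 0 :: 'a mpoly)" for h g
  define Q where "Q g h = (if h = \<phi> g then Const (1 / c g) else 0 :: 'a mpoly)" for h g
  have N: "mf_gens N = \<phi> ` mf_gens M" and inj: "inj_on \<phi> (mf_gens M)"
    using \<phi> by (auto simp: bij_betw_def)
  have eq: "\<phi> h = \<phi> g \<longleftrightarrow> h = g" if "h \<in> mf_gens M" "g \<in> mf_gens M" for h g
    using inj that by (auto dest: inj_onD)
  have u: "Const (c g) * Const (1 / c g) = (1 :: 'a mpoly)" "Const (1 / c g) * Const (c g) = (1 :: 'a mpoly)"
    if "g \<in> mf_gens M" for g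
    using c[OF that] by (simp_all add: Const_mult)
  have P1: "(\<Sum>k\<in>mf_gens M. P (\<phi> h) k * f k) = Const (c h) * f h" if "h \<in> mf_gens M" for h f
  proof -
    have "(\<Sum>k\<in>mf_gens M. P (\<phi> h) k * f k) = (\<Sum>k\<in>mf_gens M. if h = k then Const (c k) * f k else 0)"
      using that by (intro sum.cong) (auto simp: P_def eq)
    then show ?thesis using that fin by simp
  qed
  have P2: "(\<Sum>k\<in>mf_gens N. f k * P k g) = f (\<phi> g) * Const (c g)" if "g \<in> mf_gens M" for g f
  proof -
    have "(\<Sum>k\<in>mf_gens N. f k * P k g) = (\<Sum>k\<in>mf_gens N. if k = \<phi> g then f k * Const (c g) else 0)"
      by (intro sum.cong) (auto simp: P_def)
    then show ?thesis using that fin N by simp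
  qed
  have "mat_graded X M N P"
    by (auto simp: mat_graded_def P_def deg odd)
  moreover have "mat_graded X N M Q"
    by (auto simp: mat_graded_def Q_def deg odd)
  moreover have "mat_chain M N P"
    unfolding mat_chain_def mat_mult_def N ball_simps
    by (intro ballI) (simp add: P1 P2 coef flip: N)
  moreover have "mat_left_inv M N P Q"
    unfolding mat_left_inv_def mat_mult_def
    by (intro ballI) (auto simp: P2 Q_def u eq kron_def)
  moreover have "mat_left_inv N M Q P"
    unfolding mat_left_inv_def mat_mult_def N ball_simps
    by (intro ballI) (auto simp: P1 Q_def u eq kron_def)
  moreover have "finite (mf_gens N)"
    using fin N by simp
  ultimately show ?thesis
    unfolding mat_iso_def using fin by blast
qed

text \<open>The isomorphism is the identity matrix plus \<open>c\<close> in row \<open>p\<close> and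
  column \<open>q\<close>; its inverse has \<open>- c\<close> there, because
  \<open>p \<noteq> q\<close>. The last hypothesis is the chain condition written entry by entry, so
  that it can be checked on finitely many generators.\<close>

lemma mat_iso_elementary:
  assumes fin: "finite (mf_gens M)" and gens: "mf_gens N = mf_gens M"
    and odd: "mf_odd N = mf_odd M" and deg: "mf_deg N = mf_deg M"
    and p: "p \<in> mf_gens M" and q: "q \<in> mf_gens M" and pq: "p \<noteq> q" "mf_odd M p = mf_odd M q"
    and c: "c \<in> poly_ring X" "homog (mf_deg M q - mf_deg M p) c"
    and coef: "\<And>h g. h \<in> mf_gens M \<Longrightarrow> g \<in> mf_gens M \<Longrightarrow>
      mf_coef M h g + (if h = p then c * mf_coef M q g else 0) =
      mf_coef N h g + (if g = q then mf_coef N h p * c else 0)"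
  shows "mat_iso X M N"
proof -
  define E where "E c h g = (if h = g then 1 else if h = p \<and> g = q then c else 0)" for c :: "'a mpoly" and h g
  have E1: "(\<Sum>k\<in>mf_gens M. E c h k * f k) = f h + (if h = p then c * f q else 0)"
    if "h \<in> mf_gens M" for c h f
  proof -
    have "(\<Sum>k\<in>mf_gens M. E c h k * f k)
        = (\<Sum>k\<in>mf_gens M. (if h = k then f k else 0) + (if k = q then if h = p then c * f k else 0 else 0))"
      using pq by (intro sum.cong) (auto simp: E_def)
    then show ?thesis using that fin q by (simp add: sum.distrib)
  qed
  have E2: "(\<Sum>k\<in>mf_gens M. f k * E c k g) = f g + (if g = q then f p * c else 0)"
    if "g \<in> mf_gens M" for c g f
  proof -
    have "(\<Sum>k\<in>mf_gens M. f k * E c k g)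
        = (\<Sum>k\<in>mf_gens M. (if k = g then f k else 0) + (if k = p then if g = q then f k * c else 0 else 0))"
      using pq by (intro sum.cong) (auto simp: E_def)
    then show ?thesis using that fin p by (simp add: sum.distrib)
  qed
  have gr: "mat_graded X M M (E c)" "mat_graded X M M (E (- c))"
    using pq c by (auto simp: mat_graded_def E_def intro: homog_minus poly_ring_closed)
  then have "mat_graded X M N (E c)" "mat_graded X N M (E (- c))"
    by (simp_all add: mat_graded_def gens odd deg)
  moreover have "mat_chain M N (E c)"
    unfolding mat_chain_def mat_mult_def gens by (intro ballI) (simp add: E1 E2 coef)
  moreover have "mat_left_inv M N (E c) (E (- c))" "mat_left_inv N M (E (- c)) (E c)"
    unfolding mat_left_inv_def mat_mult_def gens using pq
    by (intro ballI, simp add: E1, simp add: E_def kron_def)+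
  ultimately show ?thesis
    unfolding mat_iso_def using fin gens by auto
qed

lemma mat_iso_refl: "finite (mf_gens M) \<Longrightarrow> mat_iso X M M"
  by (rule mat_iso_monomial[where \<phi> = id and c = "\<lambda>_. 1"]) auto

section \<open>From matrices to homomorphisms of matrix factorizations\<close>

text \<open>The omitted terms vanish since \<open>P\<close> preserves parity. The case
  \<open>b = False\<close> gives the square with \<open>mf_d0\<close>, the case
  \<open>b = True\<close> the one with \<open>mf_d1\<close>.\<close>

lemma mat_chain_even_odd:
  assumes fin: "finite (mf_gens M)" and fin': "finite (mf_gens N)"
    and P: "mat_graded X M N P" "mat_chain M N P"
    and h: "h \<in> mf_gens N" and g: "g \<in> mf_gens M"
  shows "mf_odd N h \<noteq> b \<Longrightarrow> mf_odd M g = b \<Longrightarrow>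
    (\<Sum>k\<in>{k\<in>mf_gens M. mf_odd M k \<noteq> b}. P h k * mf_coef M k g) =
    (\<Sum>k\<in>{k\<in>mf_gens N. mf_odd N k = b}. mf_coef N h k * P k g)"
proof -
  assume b: "mf_odd N h \<noteq> b" "mf_odd M g = b"
  have "(\<Sum>k\<in>{k\<in>mf_gens M. mf_odd M k \<noteq> b}. P h k * mf_coef M k g) = (\<Sum>k\<in>mf_gens M. P h k * mf_coef M k g)"
    using fin P h g b by (intro sum.mono_neutral_left) (auto simp: mat_graded_def)
  also have "\<dots> = (\<Sum>k\<in>mf_gens N. mf_coef N h k * P k g)"
    using P h g by (auto simp: mat_chain_def mat_mult_def)
  also have "\<dots> = (\<Sum>k\<in>{k\<in>mf_gens N. mf_odd N k = b}. mf_coef N h k * P k g)"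
    using fin' P h g b by (intro sum.mono_neutral_right) (auto simp: mat_graded_def)
  finally show ?thesis .
qed

lemma mat_left_inv_even_odd:
  assumes fin: "finite (mf_gens N)"
    and P: "mat_graded X M N P" "mat_graded X N M Q" "mat_left_inv M N P Q"
    and h: "h \<in> mf_gens M" "mf_odd M h = b" and g: "g \<in> mf_gens M"
  shows "(\<Sum>k\<in>{k\<in>mf_gens N. mf_odd N k = b}. Q h k * P k g) = kron h g"
proof -
  have "(\<Sum>k\<in>{k\<in>mf_gens N. mf_odd N k = b}. Q h k * P k g) = (\<Sum>k\<in>mf_gens N. Q h k * P k g)"
    using fin P h g by (intro sum.mono_neutral_left) (auto simp: mat_graded_def)
  then show ?thesis using P h g by (auto simp: mat_left_inv_def mat_mult_def)
qed

lemma sum_mat_assoc: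
  fixes u :: "gen \<Rightarrow> 'e mpoly"
  shows "(\<Sum>k\<in>A. P h k * (\<Sum>g\<in>B. Q k g * u g)) = (\<Sum>g\<in>B. (\<Sum>k\<in>A. P h k * Q k g) * u g)"
  unfolding sum_distrib_left sum_distrib_right
  by (subst sum.swap) (simp add: mult.assoc)

text \<open>The value 0 outside \<open>B\<close> is forced by \<open>free_module\<close>, whose
  elements vanish off the generators.\<close>

definition mat_map :: "gen set \<Rightarrow> gen set \<Rightarrow> (gen \<Rightarrow> gen \<Rightarrow> 'e mpoly) \<Rightarrow> (gen \<Rightarrow> 'e mpoly) \<Rightarrow> gen \<Rightarrow> 'e mpoly" where
  "mat_map A B P u = (\<lambda>h. if h \<in> B then \<Sum>g\<in>A. P h g * u g else 0)"

lemma mf_d_mat_map: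
  "mf_d0 M = mat_map (mf_even_gens M) (mf_odd_gens M) (mf_coef M)"
  "mf_d1 M = mat_map (mf_odd_gens M) (mf_even_gens M) (mf_coef M)"
  by (auto simp: mf_d0_def mf_d1_def mat_map_def fun_eq_iff)

lemma mat_map_mat_map:
  "mat_map B C P (mat_map A B Q u) h = (if h \<in> C then \<Sum>g\<in>A. (\<Sum>k\<in>B. P h k * Q k g) * u g else 0)"
proof -
  have "(\<Sum>k\<in>B. P h k * (if k \<in> B then \<Sum>g\<in>A. Q k g * u g else 0)) = (\<Sum>k\<in>B. P h k * (\<Sum>g\<in>A. Q k g * u g))"
    by (intro sum.cong) auto
  then show ?thesis by (simp add: mat_map_def sum_mat_assoc)
qed

lemma linear_map_mat_map:
  assumes "\<And>h g. h \<in> B \<Longrightarrow> g \<in> A \<Longrightarrow> P h g \<in> poly_ring X"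
  shows "linear_map (poly_ring X) (free_module (poly_ring X) A) (free_module (poly_ring X) B) (mat_map A B P)"
  using assms unfolding linear_map_def mat_map_def
  by (auto simp: free_module_def distrib_left sum.distrib mult.left_commute sum_distrib_left
      intro!: poly_ring_closed ext)

lemma mat_map_inverse:
  assumes fin: "finite A" and u: "u \<in> free_module R A"
    and inv: "\<And>h g. h \<in> A \<Longrightarrow> g \<in> A \<Longrightarrow> (\<Sum>k\<in>B. Q h k * P k g) = kron h g"
  shows "mat_map B A Q (mat_map A B P u) = u"
proof
  fix h
  have "(\<Sum>g\<in>A. (\<Sum>k\<in>B. Q h k * P k g) * u g) = u h" if h: "h \<in> A"
  proof -
    have "(\<Sum>g\<in>A. (\<Sum>k\<in>B. Q h k * P k g) * u g) = (\<Sum>g\<in>A. if h = g then u g else 0)"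
      using h inv by (intro sum.cong) (auto simp: kron_def)
    then show ?thesis using fin h by simp
  qed
  then show "mat_map B A Q (mat_map A B P u) h = u h"
    using u by (auto simp: mat_map_mat_map free_module_def)
qed

text \<open>The even and odd blocks of \<open>P\<close> are the two components of the isomorphism,
  and the blocks of \<open>Q\<close> invert them.\<close>

lemma mat_iso_imp_mf_isomorphic:
  assumes "mat_iso X M N"
  shows "mf_isomorphic (poly_ring X) M N"
proof -
  from assms obtain P Q where P: "mat_graded X M N P" "mat_graded X N M Q" "mat_chain M N P"
    "mat_left_inv M N P Q" "mat_left_inv N M Q P" and fin: "finite (mf_gens M)" "finite (mf_gens N)"
    unfolding mat_iso_def by blast
  let ?R = "poly_ring X"
  \<comment> \<open>Each set of generators is needed in two forms, one for either side of
    \<open>mat_chain_even_odd\<close>.\<close>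
  have eo: "mf_even_gens K = {k\<in>mf_gens K. mf_odd K k = False}" "mf_odd_gens K = {k\<in>mf_gens K. mf_odd K k = True}"
    "mf_even_gens K = {k\<in>mf_gens K. mf_odd K k \<noteq> True}" "mf_odd_gens K = {k\<in>mf_gens K. mf_odd K k \<noteq> False}"
    for K :: "'a mf"
    by (auto simp: mf_even_gens_def mf_odd_gens_def)
  let ?f0 = "mat_map (mf_even_gens M) (mf_even_gens N) P"
  let ?f1 = "mat_map (mf_odd_gens M) (mf_odd_gens N) P"
  let ?g0 = "mat_map (mf_even_gens N) (mf_even_gens M) Q"
  let ?g1 = "mat_map (mf_odd_gens N) (mf_odd_gens M) Q"
  have lin: "linear_map ?R (mf_module0 ?R M) (mf_module0 ?R N) ?f0"
    "linear_map ?R (mf_module1 ?R M) (mf_module1 ?R N) ?f1"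
    "linear_map ?R (mf_module0 ?R N) (mf_module0 ?R M) ?g0"
    "linear_map ?R (mf_module1 ?R N) (mf_module1 ?R M) ?g1"
    using P by (auto intro!: linear_map_mat_map simp: mat_graded_def mf_even_gens_def mf_odd_gens_def)
  have homog: "homog (n - mf_deg N h) (\<Sum>g\<in>A. P h g * u g)"
    if "h \<in> mf_gens N" "A \<subseteq> mf_gens M" "mf_homog M n u" for h A u n
    using that P
    by (intro homog_sum homog_mult[of "mf_deg M g - mf_deg N h" _ "n - mf_deg M g" for g])
       (auto simp: mat_graded_def mf_homog_def)
  have gr: "graded_map M N 0 (mf_module0 ?R M) ?f0" "graded_map M N 0 (mf_module1 ?R M) ?f1"
    unfolding graded_map_def mf_homog_def[of N]
    by (auto simp: mat_map_def mf_even_gens_def mf_odd_gens_def intro!: homog)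
  have "?f1 (mf_d0 M u) = mf_d0 N (?f0 u)" for u
    unfolding mf_d_mat_map mat_map_mat_map fun_eq_iff
    using mat_chain_even_odd[OF fin P(1,3), where b = False, folded eo]
    by (auto intro!: sum.cong simp: mf_even_gens_def mf_odd_gens_def)
  moreover have "?f0 (mf_d1 M u) = mf_d1 N (?f1 u)" for u
    unfolding mf_d_mat_map mat_map_mat_map fun_eq_iff
    using mat_chain_even_odd[OF fin P(1,3), where b = True, folded eo]
    by (auto intro!: sum.cong simp: mf_even_gens_def mf_odd_gens_def)
  ultimately have hom: "mf_hom ?R 0 M N ?f0 ?f1"
    unfolding mf_hom_def using lin gr by auto
  have fin': "finite (mf_even_gens K)" "finite (mf_odd_gens K)" if "finite (mf_gens K)" for K :: "'a mf"
    using that by (auto simp: eo(1,2))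
  have inv0: "?g0 (?f0 u) = u" if "u \<in> mf_module0 ?R M" for u
    using that fin fin' mat_left_inv_even_odd[OF fin(2) P(1,2,4), where b = False]
    by (intro mat_map_inverse) (auto simp: mf_even_gens_def)
  have inv1: "?g1 (?f1 u) = u" if "u \<in> mf_module1 ?R M" for u
    using that fin fin' mat_left_inv_even_odd[OF fin(2) P(1,2,4), where b = True]
    by (intro mat_map_inverse) (auto simp: mf_odd_gens_def)
  have inv0': "?f0 (?g0 u) = u" if "u \<in> mf_module0 ?R N" for u
    using that fin fin' mat_left_inv_even_odd[OF fin(1) P(2,1,5), where b = False]
    by (intro mat_map_inverse) (auto simp: mf_even_gens_def)
  have inv1': "?f1 (?g1 u) = u" if "u \<in> mf_module1 ?R N" for u
    using that fin fin' mat_left_inv_even_odd[OF fin(1) P(2,1,5), where b = True]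
    by (intro mat_map_inverse) (auto simp: mf_odd_gens_def)
  have "bij_betw ?f0 (mf_module0 ?R M) (mf_module0 ?R N)"
    using lin by (intro bij_betw_byWitness[where f' = ?g0]) (auto simp: linear_map_def inv0 inv0')
  moreover have "bij_betw ?f1 (mf_module1 ?R M) (mf_module1 ?R N)"
    using lin by (intro bij_betw_byWitness[where f' = ?g1]) (auto simp: linear_map_def inv1 inv1')
  ultimately show ?thesis
    unfolding mf_isomorphic_def mf_iso_def using hom by blast
qed

section \<open>Tensor products\<close>

text \<open>The Kronecker product. No Koszul sign enters, as it is applied to matrices that preserve
  parity.\<close>

fun tensor_mat :: "(gen \<Rightarrow> gen \<Rightarrow> 'e mpoly) \<Rightarrow> (gen \<Rightarrow> gen \<Rightarrow> 'e mpoly) \<Rightarrow> gen \<Rightarrow> gen \<Rightarrow> 'e mpoly" where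
  "tensor_mat P Q (Tensor_gen h h') (Tensor_gen g g') = P h g * Q h' g'"
| "tensor_mat P Q _ _ = 0"

lemma mf_tensor_simps [simp]:
  "mf_gens (mf_tensor M N) = (\<lambda>(g, g'). Tensor_gen g g') ` (mf_gens M \<times> mf_gens N)"
  "mf_odd (mf_tensor M N) = tensor_odd M N"
  "mf_deg (mf_tensor M N) = tensor_deg M N"
  "mf_coef (mf_tensor M N) = tensor_coef M N"
  by (simp_all add: mf_tensor_def)

lemma sum_tensor_gens:
  "sum f (mf_gens (mf_tensor M N)) = (\<Sum>k\<in>mf_gens M. \<Sum>k'\<in>mf_gens N. f (Tensor_gen k k'))"
  by (simp add: sum.reindex inj_on_def split_def sum.cartesian_product)

lemma mat_graded_tensor:
  assumes P: "mat_graded X M M' P" and Q: "mat_graded X N N' Q"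
  shows "mat_graded X (mf_tensor M N) (mf_tensor M' N') (tensor_mat P Q)"
  unfolding mat_graded_def
proof (intro ballI)
  fix h g assume "h \<in> mf_gens (mf_tensor M' N')" "g \<in> mf_gens (mf_tensor M N)"
  then obtain h1 h2 g1 g2 where i: "h = Tensor_gen h1 h2" "g = Tensor_gen g1 g2"
    "h1 \<in> mf_gens M'" "h2 \<in> mf_gens N'" "g1 \<in> mf_gens M" "g2 \<in> mf_gens N"
    by auto
  have "P h1 g1 \<in> poly_ring X" "homog (mf_deg M g1 - mf_deg M' h1) (P h1 g1)"
    "mf_odd M' h1 \<noteq> mf_odd M g1 \<longrightarrow> P h1 g1 = 0"
    "Q h2 g2 \<in> poly_ring X" "homog (mf_deg N g2 - mf_deg N' h2) (Q h2 g2)"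
    "mf_odd N' h2 \<noteq> mf_odd N g2 \<longrightarrow> Q h2 g2 = 0"
    using P Q i by (auto simp: mat_graded_def)
  then show "tensor_mat P Q h g \<in> poly_ring X \<and>
      homog (mf_deg (mf_tensor M N) g - mf_deg (mf_tensor M' N') h) (tensor_mat P Q h g) \<and>
      (mf_odd (mf_tensor M' N') h \<noteq> mf_odd (mf_tensor M N) g \<longrightarrow> tensor_mat P Q h g = 0)"
    by (auto simp: i intro!: poly_ring_closed
        homog_mult[of "mf_deg M g1 - mf_deg M' h1" _ "mf_deg N g2 - mf_deg N' h2"])
qed

lemma mat_left_inv_tensor:
  assumes P: "mat_left_inv M M' P P'" and Q: "mat_left_inv N N' Q Q'"
  shows "mat_left_inv (mf_tensor M N) (mf_tensor M' N') (tensor_mat P Q) (tensor_mat P' Q')"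
  unfolding mat_left_inv_def mat_mult_def
proof (intro ballI)
  fix h g assume "h \<in> mf_gens (mf_tensor M N)" "g \<in> mf_gens (mf_tensor M N)"
  then obtain h1 h2 g1 g2 where i: "h = Tensor_gen h1 h2" "g = Tensor_gen g1 g2"
    "h1 \<in> mf_gens M" "h2 \<in> mf_gens N" "g1 \<in> mf_gens M" "g2 \<in> mf_gens N"
    by auto
  have "(\<Sum>k\<in>mf_gens (mf_tensor M' N'). tensor_mat P' Q' h k * tensor_mat P Q k g) =
      (\<Sum>k\<in>mf_gens M'. P' h1 k * P k g1) * (\<Sum>k\<in>mf_gens N'. Q' h2 k * Q k g2)"
    unfolding sum_tensor_gens sum_product by (simp add: i mult_ac)
  also have "\<dots> = kron h1 g1 * kron h2 g2"
    using P Q i by (simp add: mat_left_inv_def mat_mult_def)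
  finally show "(\<Sum>k\<in>mf_gens (mf_tensor M' N'). tensor_mat P' Q' h k * tensor_mat P Q k g) = kron h g"
    by (simp add: i kron_def)
qed

lemma mat_chain_tensor:
  assumes fin: "finite (mf_gens M)" "finite (mf_gens N)" "finite (mf_gens M')" "finite (mf_gens N')"
    and P: "mat_graded X M M' P" "mat_chain M M' P" and Q: "mat_chain N N' Q"
  shows "mat_chain (mf_tensor M N) (mf_tensor M' N') (tensor_mat P Q)"
  unfolding mat_chain_def mat_mult_def
proof (intro ballI)
  fix h g assume "h \<in> mf_gens (mf_tensor M' N')" "g \<in> mf_gens (mf_tensor M N)"
  then obtain h1 h2 g1 g2 where i: "h = Tensor_gen h1 h2" "g = Tensor_gen g1 g2"
    "h1 \<in> mf_gens M'" "h2 \<in> mf_gens N'" "g1 \<in> mf_gens M" "g2 \<in> mf_gens N"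
    by auto
  let ?s = "\<lambda>M g (x :: 'a mpoly). if mf_odd M g then - x else x"
  have "(\<Sum>k\<in>mf_gens (mf_tensor M N). tensor_mat P Q h k * mf_coef (mf_tensor M N) k g) =
     (\<Sum>k\<in>mf_gens M. \<Sum>k'\<in>mf_gens N. (if k' = g2 then P h1 k * mf_coef M k g1 * Q h2 k' else 0)) +
     (\<Sum>k\<in>mf_gens M. \<Sum>k'\<in>mf_gens N. (if k = g1 then ?s M g1 (P h1 g1 * (Q h2 k' * mf_coef N k' g2)) else 0))"
    unfolding sum_tensor_gens sum.distrib[symmetric]
    by (intro sum.cong refl) (auto simp: i algebra_simps)
  also have "(\<Sum>k\<in>mf_gens M. \<Sum>k'\<in>mf_gens N. (if k' = g2 then P h1 k * mf_coef M k g1 * Q h2 k' else 0)) =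
     (\<Sum>k\<in>mf_gens M. P h1 k * mf_coef M k g1) * Q h2 g2"
    using fin i by (simp add: sum_distrib_right)
  also have "(\<Sum>k\<in>mf_gens M. P h1 k * mf_coef M k g1) = (\<Sum>k\<in>mf_gens M'. mf_coef M' h1 k * P k g1)"
    using P i by (simp add: mat_chain_def mat_mult_def)
  also have "(\<Sum>k\<in>mf_gens M. \<Sum>k'\<in>mf_gens N. (if k = g1 then ?s M g1 (P h1 g1 * (Q h2 k' * mf_coef N k' g2)) else 0)) =
     (\<Sum>k'\<in>mf_gens N. ?s M g1 (P h1 g1 * (Q h2 k' * mf_coef N k' g2)))"
    using fin i by (subst sum.swap) (simp cong: if_cong)
  also have "\<dots> = ?s M g1 (P h1 g1 * (\<Sum>k'\<in>mf_gens N. Q h2 k' * mf_coef N k' g2))"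
    by (simp add: sum_distrib_left sum_negf)
  \<comment> \<open>The sign may be read off at \<open>h1\<close> in the target instead of
    \<open>g1\<close> in the source: where the two parities differ, \<open>P h1 g1\<close> is
    0.\<close>
  also have "\<dots> = ?s M' h1 (P h1 g1 * (\<Sum>k'\<in>mf_gens N'. mf_coef N' h2 k' * Q k' g2))"
    using P Q i by (auto simp: mat_chain_def mat_mult_def mat_graded_def)
  finally have 1: "(\<Sum>k\<in>mf_gens (mf_tensor M N). tensor_mat P Q h k * mf_coef (mf_tensor M N) k g) =
    (\<Sum>k\<in>mf_gens M'. mf_coef M' h1 k * P k g1) * Q h2 g2 +
    ?s M' h1 (P h1 g1 * (\<Sum>k'\<in>mf_gens N'. mf_coef N' h2 k' * Q k' g2))" .
  have "(\<Sum>k\<in>mf_gens (mf_tensor M' N'). mf_coef (mf_tensor M' N') h k * tensor_mat P Q k g) =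
     (\<Sum>k\<in>mf_gens M'. \<Sum>k'\<in>mf_gens N'. (if h2 = k' then mf_coef M' h1 k * P k g1 * Q k' g2 else 0)) +
     (\<Sum>k\<in>mf_gens M'. \<Sum>k'\<in>mf_gens N'. (if h1 = k then ?s M' h1 (P h1 g1 * (mf_coef N' h2 k' * Q k' g2)) else 0))"
    unfolding sum_tensor_gens sum.distrib[symmetric]
    by (intro sum.cong refl) (auto simp: i algebra_simps)
  also have "(\<Sum>k\<in>mf_gens M'. \<Sum>k'\<in>mf_gens N'. (if h2 = k' then mf_coef M' h1 k * P k g1 * Q k' g2 else 0)) =
     (\<Sum>k\<in>mf_gens M'. mf_coef M' h1 k * P k g1) * Q h2 g2"
    using fin i by (simp add: sum_distrib_right)
  also have "(\<Sum>k\<in>mf_gens M'. \<Sum>k'\<in>mf_gens N'. (if h1 = k then ?s M' h1 (P h1 g1 * (mf_coef N' h2 k' * Q k' g2)) else 0)) =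
     (\<Sum>k'\<in>mf_gens N'. ?s M' h1 (P h1 g1 * (mf_coef N' h2 k' * Q k' g2)))"
    using fin i by (subst sum.swap) (simp cong: if_cong)
  also have "\<dots> = ?s M' h1 (P h1 g1 * (\<Sum>k'\<in>mf_gens N'. mf_coef N' h2 k' * Q k' g2))"
    by (simp add: sum_distrib_left sum_negf)
  finally show "(\<Sum>k\<in>mf_gens (mf_tensor M N). tensor_mat P Q h k * mf_coef (mf_tensor M N) k g) =
    (\<Sum>k\<in>mf_gens (mf_tensor M' N'). mf_coef (mf_tensor M' N') h k * tensor_mat P Q k g)"
    unfolding 1 by simp
qed

lemma mat_iso_tensor:
  assumes "mat_iso X M M'" "mat_iso X N N'"
  shows "mat_iso X (mf_tensor M N) (mf_tensor M' N')"
proof -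
  from assms(1) obtain P P' where P: "mat_graded X M M' P" "mat_graded X M' M P'" "mat_chain M M' P"
    "mat_left_inv M M' P P'" "mat_left_inv M' M P' P"
    unfolding mat_iso_def by blast
  from assms(2) obtain Q Q' where Q: "mat_graded X N N' Q" "mat_graded X N' N Q'" "mat_chain N N' Q"
    "mat_left_inv N N' Q Q'" "mat_left_inv N' N Q' Q"
    unfolding mat_iso_def by blast
  have fin: "finite (mf_gens M)" "finite (mf_gens M')" "finite (mf_gens N)" "finite (mf_gens N')"
    using assms by (auto simp: mat_iso_def)
  show ?thesis
    unfolding mat_iso_def using P Q fin
    by (intro conjI exI[of _ "tensor_mat P Q"] exI[of _ "tensor_mat P' Q'"]
          mat_graded_tensor mat_left_inv_tensor mat_chain_tensor[of _ _ _ _ X]) auto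
qed

section \<open>Symmetry, associativity and unit of the tensor product\<close>

text \<open>Besides finiteness, only the oddness of the differential is recorded; the sign changes
  in the symmetry and in shifts of the second factor depend on it.\<close>

definition wf_mf :: "'e mf \<Rightarrow> bool" where
  "wf_mf M \<longleftrightarrow> finite (mf_gens M) \<and>
     (\<forall>h\<in>mf_gens M. \<forall>g\<in>mf_gens M. mf_odd M h = mf_odd M g \<longrightarrow> mf_coef M h g = 0)"

lemma wf_mf_finite: "wf_mf M \<Longrightarrow> finite (mf_gens M)"
  by (simp add: wf_mf_def)

lemma wf_mf_unit: "wf_mf mf_unit"
  by (simp add: wf_mf_def mf_unit_def)

lemma wf_mf_elem: "wf_mf (elem_mf A dA B dB)"
  by (auto simp: wf_mf_def elem_mf_def)

lemma wf_mf_shift_1: "wf_mf M \<Longrightarrow> wf_mf (shift_1 M)"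
  by (simp add: wf_mf_def shift_1_def)

lemma wf_mf_shift_q: "wf_mf M \<Longrightarrow> wf_mf (shift_q j M)"
  by (simp add: wf_mf_def shift_q_def)

lemma wf_mf_tensor: "wf_mf M \<Longrightarrow> wf_mf N \<Longrightarrow> wf_mf (mf_tensor M N)"
  by (auto simp: wf_mf_def)

lemma wf_mf_tensor_list: "(\<And>M. M \<in> set Ms \<Longrightarrow> wf_mf M) \<Longrightarrow> wf_mf (mf_tensor_list Ms)"
  by (induction Ms) (simp_all add: mf_tensor_list_def wf_mf_unit wf_mf_tensor)

lemma mf_tensor_list_simps [simp]:
  "mf_tensor_list [] = mf_unit" "mf_tensor_list (M # Ms) = mf_tensor M (mf_tensor_list Ms)"
  by (simp_all add: mf_tensor_list_def)

text \<open>The swap carries the Koszul sign, -1 when both generators are odd. A differential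
  changes the parity of exactly one factor, which accounts for the signs in the tensor
  differential.\<close>

lemma mat_iso_tensor_commute:
  assumes M: "wf_mf M" and N: "wf_mf N"
  shows "mat_iso X (mf_tensor M N) (mf_tensor N M)"
proof -
  let ?\<phi> = "\<lambda>t. case t of Tensor_gen g g' \<Rightarrow> Tensor_gen g' g | _ \<Rightarrow> t"
  let ?c = "\<lambda>t. case t of Tensor_gen g g' \<Rightarrow> if mf_odd M g \<and> mf_odd N g' then - 1 else 1 | _ \<Rightarrow> (1 :: rat)"
  show ?thesis
  proof (rule mat_iso_monomial[where \<phi> = ?\<phi> and c = ?c])
    show "bij_betw ?\<phi> (mf_gens (mf_tensor M N)) (mf_gens (mf_tensor N M))"
      by (rule bij_betw_byWitness[where f' = ?\<phi>]) auto
    fix h g assume "h \<in> mf_gens (mf_tensor M N)" "g \<in> mf_gens (mf_tensor M N)"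
    then obtain h1 h2 g1 g2 where i: "h = Tensor_gen h1 h2" "g = Tensor_gen g1 g2"
      "h1 \<in> mf_gens M" "h2 \<in> mf_gens N" "g1 \<in> mf_gens M" "g2 \<in> mf_gens N"
      by auto
    have "mf_odd M h1 = mf_odd M g1 \<longrightarrow> mf_coef M h1 g1 = 0" "mf_odd N h2 = mf_odd N g2 \<longrightarrow> mf_coef N h2 g2 = 0"
      using M N i by (auto simp: wf_mf_def)
    then show "Const (?c h) * mf_coef (mf_tensor M N) h g = mf_coef (mf_tensor N M) (?\<phi> h) (?\<phi> g) * Const (?c g)"
      by (auto simp: i Const_minus)
  qed (use M N in \<open>auto simp: wf_mf_def split: if_splits\<close>)
qed

lemma mat_iso_tensor_assoc:
  assumes "finite (mf_gens M)" "finite (mf_gens N)" "finite (mf_gens L)"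
  shows "mat_iso X (mf_tensor (mf_tensor M N) L) (mf_tensor M (mf_tensor N L))"
proof -
  let ?\<phi> = "\<lambda>t. case t of Tensor_gen (Tensor_gen a b) c \<Rightarrow> Tensor_gen a (Tensor_gen b c) | _ \<Rightarrow> t"
  let ?\<psi> = "\<lambda>t. case t of Tensor_gen a (Tensor_gen b c) \<Rightarrow> Tensor_gen (Tensor_gen a b) c | _ \<Rightarrow> t"
  show ?thesis
  proof (rule mat_iso_monomial[where \<phi> = ?\<phi> and c = "\<lambda>_. 1"])
    show "bij_betw ?\<phi> (mf_gens (mf_tensor (mf_tensor M N) L)) (mf_gens (mf_tensor M (mf_tensor N L)))"
      by (rule bij_betw_byWitness[where f' = ?\<psi>]) (auto simp: image_iff)
  qed (use assms in auto)
qed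

lemma mat_iso_unit_tensor:
  assumes "finite (mf_gens M)"
  shows "mat_iso X (mf_tensor mf_unit M) M"
proof -
  let ?\<phi> = "\<lambda>t. case t of Tensor_gen a b \<Rightarrow> b | _ \<Rightarrow> t"
  show ?thesis
  proof (rule mat_iso_monomial[where \<phi> = ?\<phi> and c = "\<lambda>_. 1"])
    show "bij_betw ?\<phi> (mf_gens (mf_tensor mf_unit M)) (mf_gens M)"
      by (rule bij_betw_byWitness[where f' = "Tensor_gen Even_gen"]) (auto simp: mf_unit_def)
  qed (use assms in \<open>auto simp: mf_unit_def\<close>)
qed

section \<open>Shifts of both gradings and their passage through tensor products\<close>

lemma shift_1_simps [simp]:
  "mf_gens (shift_1 M) = mf_gens M" "mf_odd (shift_1 M) = (\<lambda>g. \<not> mf_odd M g)"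
  "mf_deg (shift_1 M) = mf_deg M" "mf_coef (shift_1 M) = (\<lambda>h g. - mf_coef M h g)"
  by (simp_all add: shift_1_def)

lemma shift_q_simps [simp]:
  "mf_gens (shift_q j M) = mf_gens M" "mf_odd (shift_q j M) = mf_odd M"
  "mf_deg (shift_q j M) = (\<lambda>g. mf_deg M g + j)" "mf_coef (shift_q j M) = mf_coef M"
  by (simp_all add: shift_q_def)

lemma shift_1_shift_1 [simp]: "shift_1 (shift_1 M) = M"
  by (simp add: shift_1_def)

lemma shift_q_shift_1: "shift_q j (shift_1 M) = shift_1 (shift_q j M)"
  by (cases M) (simp add: shift_1_def shift_q_def)

lemma mat_iso_same:
  assumes "finite (mf_gens M)" "mf_gens N = mf_gens M"
    and "\<And>g. g \<in> mf_gens M \<Longrightarrow> mf_deg N g = mf_deg M g" "\<And>g. g \<in> mf_gens M \<Longrightarrow> mf_odd N g = mf_odd M g"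
    and "\<And>h g. h \<in> mf_gens M \<Longrightarrow> g \<in> mf_gens M \<Longrightarrow> mf_coef N h g = mf_coef M h g"
  shows "mat_iso X M N"
  by (rule mat_iso_monomial[where \<phi> = id and c = "\<lambda>_. 1"]) (use assms in auto)

lemma mat_iso_shift_1: "mat_iso X M N \<Longrightarrow> mat_iso X (shift_1 M) (shift_1 N)"
  by (simp add: mat_iso_def mat_graded_def mat_chain_def mat_left_inv_def mat_mult_def sum_negf)

lemma mat_iso_shift_q: "mat_iso X M N \<Longrightarrow> mat_iso X (shift_q j M) (shift_q j N)"
  by (simp add: mat_iso_def mat_graded_def mat_chain_def mat_left_inv_def mat_mult_def)

lemma mat_iso_tensor_shift_q:
  assumes "finite (mf_gens M)" "finite (mf_gens N)"
  shows "mat_iso X (mf_tensor (shift_q i M) (shift_q j N)) (shift_q (i + j) (mf_tensor M N))"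
  using assms by (intro mat_iso_same) auto

text \<open>On generators the two differentials coincide: reversing the parity of the first factor
  also reverses the sign in front of the second differential.\<close>

lemma mat_iso_shift_1_tensor:
  assumes "finite (mf_gens M)" "finite (mf_gens N)"
  shows "mat_iso X (mf_tensor (shift_1 M) N) (shift_1 (mf_tensor M N))"
  using assms by (intro mat_iso_same) auto

text \<open>The two sides differ in the sign of the differential of \<open>M\<close>. Rescaling by
  the parity of the first generator corrects this, since that differential is odd.\<close>

lemma mat_iso_tensor_shift_1:
  assumes M: "wf_mf M" and N: "finite (mf_gens N)"
  shows "mat_iso X (mf_tensor M (shift_1 N)) (shift_1 (mf_tensor M N))"
proof -
  let ?c = "\<lambda>t. case t of Tensor_gen g g' \<Rightarrow> if mf_odd M g then - 1 else 1 | _ \<Rightarrow> (1 :: rat)"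
  show ?thesis
  proof (rule mat_iso_monomial[where \<phi> = id and c = ?c])
    fix h g assume "h \<in> mf_gens (mf_tensor M (shift_1 N))" "g \<in> mf_gens (mf_tensor M (shift_1 N))"
    then obtain h1 h2 g1 g2 where i: "h = Tensor_gen h1 h2" "g = Tensor_gen g1 g2"
      "h1 \<in> mf_gens M" "h2 \<in> mf_gens N" "g1 \<in> mf_gens M" "g2 \<in> mf_gens N"
      by auto
    have "mf_odd M h1 = mf_odd M g1 \<longrightarrow> mf_coef M h1 g1 = 0"
      using M i by (auto simp: wf_mf_def)
    then show "Const (?c h) * mf_coef (mf_tensor M (shift_1 N)) h g =
        mf_coef (shift_1 (mf_tensor M N)) (id h) (id g) * Const (?c g)"
      by (auto simp: i Const_minus)
  qed (use M N in \<open>auto simp: wf_mf_def split: if_splits\<close>)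
qed

section \<open>Isomorphism up to a shift of the parity\<close>

definition mf_equiv :: "'e var set \<Rightarrow> 'e mf \<Rightarrow> 'e mf \<Rightarrow> bool" where
  "mf_equiv X M N \<longleftrightarrow> mat_iso X M N \<or> mat_iso X M (shift_1 N)"

lemma mat_iso_imp_mf_equiv: "mat_iso X M N \<Longrightarrow> mf_equiv X M N"
  by (simp add: mf_equiv_def)

lemma mf_equiv_imp_mf_isomorphic:
  "mf_equiv X M N \<Longrightarrow> mf_isomorphic (poly_ring X) M N \<or> mf_isomorphic (poly_ring X) M (shift_1 N)"
  by (auto simp: mf_equiv_def intro: mat_iso_imp_mf_isomorphic)

lemma mf_equiv_refl: "finite (mf_gens M) \<Longrightarrow> mf_equiv X M M"
  by (simp add: mf_equiv_def mat_iso_refl)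

text \<open>Symmetry, like transitivity below, rests on \<open>shift_1\<close> being an involution
  that respects \<open>mat_iso\<close>.\<close>

lemma mf_equiv_sym: "mf_equiv X M N \<Longrightarrow> mf_equiv X N M"
  unfolding mf_equiv_def by (metis mat_iso_shift_1 mat_iso_sym shift_1_shift_1)

lemma mf_equiv_trans [trans]: "mf_equiv X L M \<Longrightarrow> mf_equiv X M N \<Longrightarrow> mf_equiv X L N"
  unfolding mf_equiv_def by (metis mat_iso_shift_1 mat_iso_trans shift_1_shift_1)

lemma mf_equiv_shift_1: "finite (mf_gens M) \<Longrightarrow> mf_equiv X (shift_1 M) M"
  by (simp add: mf_equiv_def mat_iso_refl)

lemma mf_equiv_shift_q: "mf_equiv X M N \<Longrightarrow> mf_equiv X (shift_q j M) (shift_q j N)"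
  using mat_iso_shift_q[of X M N j] mat_iso_shift_q[of X M "shift_1 N" j]
  by (auto simp: mf_equiv_def shift_q_shift_1)

text \<open>A parity shift of one factor becomes a parity shift of the whole product.\<close>

lemma mf_equiv_tensor_left:
  assumes "mf_equiv X M M'" "finite (mf_gens N)"
  shows "mf_equiv X (mf_tensor M N) (mf_tensor M' N)"
  using assms(1) unfolding mf_equiv_def
proof
  assume "mat_iso X M (shift_1 M')"
  then have "mat_iso X (mf_tensor M N) (mf_tensor (shift_1 M') N)" "finite (mf_gens M')"
    using assms by (auto intro: mat_iso_tensor mat_iso_refl) (auto simp: mat_iso_def)
  then show "mat_iso X (mf_tensor M N) (mf_tensor M' N) \<or> mat_iso X (mf_tensor M N) (shift_1 (mf_tensor M' N))"
    using assms mat_iso_trans mat_iso_shift_1_tensor by blast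
qed (use assms in \<open>auto intro: mat_iso_tensor mat_iso_refl\<close>)

lemma mf_equiv_tensor_right:
  assumes "mf_equiv X N N'" "wf_mf M"
  shows "mf_equiv X (mf_tensor M N) (mf_tensor M N')"
  using assms(1) unfolding mf_equiv_def
proof
  assume "mat_iso X N (shift_1 N')"
  then have "mat_iso X (mf_tensor M N) (mf_tensor M (shift_1 N'))" "finite (mf_gens N')"
    using assms by (auto intro: mat_iso_tensor mat_iso_refl wf_mf_finite) (auto simp: mat_iso_def)
  then show "mat_iso X (mf_tensor M N) (mf_tensor M N') \<or> mat_iso X (mf_tensor M N) (shift_1 (mf_tensor M N'))"
    using assms mat_iso_trans mat_iso_tensor_shift_1 by blast
qed (use assms in \<open>auto intro: mat_iso_tensor mat_iso_refl wf_mf_finite\<close>)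

section \<open>Reordering and replacing factors in iterated tensor products\<close>

lemma mf_equiv_tensor_assoc:
  "wf_mf M \<Longrightarrow> wf_mf N \<Longrightarrow> wf_mf L \<Longrightarrow>
   mf_equiv X (mf_tensor (mf_tensor M N) L) (mf_tensor M (mf_tensor N L))"
  by (intro mat_iso_imp_mf_equiv mat_iso_tensor_assoc wf_mf_finite)

lemma mf_equiv_tensor_left_commute:
  assumes "wf_mf M" "wf_mf N" "wf_mf L"
  shows "mf_equiv X (mf_tensor M (mf_tensor N L)) (mf_tensor N (mf_tensor M L))"
proof -
  have "mf_equiv X (mf_tensor M (mf_tensor N L)) (mf_tensor (mf_tensor M N) L)"
    using assms by (intro mf_equiv_sym[OF mf_equiv_tensor_assoc])
  also have "mf_equiv X \<dots> (mf_tensor (mf_tensor N M) L)"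
    using assms by (intro mf_equiv_tensor_left mat_iso_imp_mf_equiv mat_iso_tensor_commute wf_mf_finite)
  also have "mf_equiv X \<dots> (mf_tensor N (mf_tensor M L))"
    using assms by (intro mf_equiv_tensor_assoc)
  finally show ?thesis .
qed

lemma mf_equiv_tensor_list_move:
  assumes "wf_mf M" "\<And>N. N \<in> set As \<union> set Bs \<Longrightarrow> wf_mf N"
  shows "mf_equiv X (mf_tensor_list (As @ M # Bs)) (mf_tensor_list (M # As @ Bs))"
  using assms(2)
proof (induction As)
  case Nil
  then show ?case using assms(1)
    by (auto intro!: mf_equiv_refl wf_mf_tensor wf_mf_tensor_list wf_mf_finite simp del: mf_tensor_simps)
next
  case (Cons A As)
  have "mf_equiv X (mf_tensor_list ((A # As) @ M # Bs)) (mf_tensor A (mf_tensor_list (M # As @ Bs)))"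
    using Cons by (auto intro!: mf_equiv_tensor_right)
  also have "mf_equiv X \<dots> (mf_tensor_list (M # (A # As) @ Bs))"
    using Cons.prems assms(1) by (auto intro!: mf_equiv_tensor_left_commute wf_mf_tensor_list)
  finally show ?case .
qed

text \<open>Induction on the first list: its head occurs somewhere in the second list and can be
  moved to the front there.\<close>

lemma mf_equiv_tensor_list_perm:
  assumes "mset Ms = mset Ns" "\<And>M. M \<in> set Ms \<Longrightarrow> wf_mf M"
  shows "mf_equiv X (mf_tensor_list Ms) (mf_tensor_list Ns)"
  using assms
proof (induction Ms arbitrary: Ns)
  case Nil
  then show ?case by (auto intro!: mf_equiv_refl wf_mf_finite wf_mf_unit)
next
  case (Cons M Ms)
  then have "M \<in> set Ns" by (metis list.set_intros(1) set_mset_mset)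
  then obtain As Bs where Ns: "Ns = As @ M # Bs" by (auto simp: in_set_conv_decomp)
  then have "mset Ms = mset (As @ Bs)" using Cons.prems by simp
  moreover from this have "set Ms = set (As @ Bs)" by (metis set_mset_mset)
  ultimately have "mf_equiv X (mf_tensor_list (M # Ms)) (mf_tensor_list (M # As @ Bs))"
    using Cons by (auto intro!: mf_equiv_tensor_right)
  also have "mf_equiv X \<dots> (mf_tensor_list Ns)"
    unfolding Ns using Cons.prems \<open>set Ms = set (As @ Bs)\<close>
    by (intro mf_equiv_sym[OF mf_equiv_tensor_list_move]) auto
  finally show ?case .
qed

lemma mf_equiv_tensor_list_append:
  assumes "\<And>M. M \<in> set Ms \<union> set Ns \<Longrightarrow> wf_mf M"
  shows "mf_equiv X (mf_tensor_list (Ms @ Ns)) (mf_tensor (mf_tensor_list Ms) (mf_tensor_list Ns))"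
  using assms
proof (induction Ms)
  case Nil
  then show ?case
    by (auto intro!: mf_equiv_sym[OF mat_iso_imp_mf_equiv] mat_iso_unit_tensor wf_mf_finite wf_mf_tensor_list)
next
  case (Cons M Ms)
  have "mf_equiv X (mf_tensor_list ((M # Ms) @ Ns)) (mf_tensor M (mf_tensor (mf_tensor_list Ms) (mf_tensor_list Ns)))"
    using Cons by (auto intro!: mf_equiv_tensor_right)
  also have "mf_equiv X \<dots> (mf_tensor (mf_tensor_list (M # Ms)) (mf_tensor_list Ns))"
    using Cons.prems by (auto intro!: mf_equiv_sym[OF mf_equiv_tensor_assoc] wf_mf_tensor_list)
  finally show ?case .
qed

text \<open>An initial block of factors may be replaced; with
  \<open>mf_equiv_tensor_list_perm\<close> any block can be made initial.\<close>

lemma mf_equiv_tensor_list_cong: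
  assumes "mf_equiv X (mf_tensor_list Ms) (mf_tensor_list Ms')"
    "\<And>M. M \<in> set Ms \<union> set Ms' \<union> set Ns \<Longrightarrow> wf_mf M"
  shows "mf_equiv X (mf_tensor_list (Ms @ Ns)) (mf_tensor_list (Ms' @ Ns))"
proof -
  have "mf_equiv X (mf_tensor_list (Ms @ Ns)) (mf_tensor (mf_tensor_list Ms) (mf_tensor_list Ns))"
    using assms(2) by (intro mf_equiv_tensor_list_append) auto
  also have "mf_equiv X \<dots> (mf_tensor (mf_tensor_list Ms') (mf_tensor_list Ns))"
    using assms by (intro mf_equiv_tensor_left wf_mf_finite wf_mf_tensor_list) auto
  also have "mf_equiv X \<dots> (mf_tensor_list (Ms' @ Ns))"
    using assms(2) by (intro mf_equiv_sym[OF mf_equiv_tensor_list_append]) auto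
  finally show ?thesis .
qed

section \<open>Row operations on Koszul matrices\<close>

text \<open>A row carries the degree \<open>d\<close> of its right entry; the potential has degree \<open>8\<close>.\<close>

definition koszul_row :: "int \<times> 'e mpoly \<times> 'e mpoly \<Rightarrow> 'e mf" where
  "koszul_row = (\<lambda>(d, A, B). elem_mf A (8 - d) B d)"

definition koszul :: "(int \<times> 'e mpoly \<times> 'e mpoly) list \<Rightarrow> 'e mf" where
  "koszul rows = mf_tensor_list (map koszul_row rows)"

text \<open>Multisets let a row operation address any two rows regardless of their position. By
  \<open>koszul_perm\<close> it makes no difference whether one or all orderings are
  considered.\<close>

definition koszul_equiv ::
  "'e var set \<Rightarrow> (int \<times> 'e mpoly \<times> 'e mpoly) multiset \<Rightarrow> (int \<times> 'e mpoly \<times> 'e mpoly) multiset \<Rightarrow> bool" where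
  "koszul_equiv X S T \<longleftrightarrow> (\<forall>xs ys. mset xs = S \<longrightarrow> mset ys = T \<longrightarrow> mf_equiv X (koszul xs) (koszul ys))"

lemma wf_koszul_row: "wf_mf (koszul_row r)"
  by (simp add: koszul_row_def wf_mf_elem split: prod.split)

lemma wf_koszul: "wf_mf (koszul rows)"
  unfolding koszul_def by (intro wf_mf_tensor_list) (auto simp: wf_koszul_row)

lemma koszul_perm: "mset xs = mset ys \<Longrightarrow> mf_equiv X (koszul xs) (koszul ys)"
  unfolding koszul_def by (intro mf_equiv_tensor_list_perm) (auto simp: wf_koszul_row)

lemma koszul_equiv_mset: "koszul_equiv X (mset xs) (mset ys) \<longleftrightarrow> mf_equiv X (koszul xs) (koszul ys)"
proof
  assume *: "mf_equiv X (koszul xs) (koszul ys)"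
  show "koszul_equiv X (mset xs) (mset ys)"
    unfolding koszul_equiv_def
  proof (intro allI impI)
    fix xs' ys' assume "mset xs' = mset xs" "mset ys' = mset ys"
    then have "mf_equiv X (koszul xs') (koszul xs)" "mf_equiv X (koszul ys) (koszul ys')"
      by (auto intro: koszul_perm)
    then show "mf_equiv X (koszul xs') (koszul ys')"
      using * mf_equiv_trans by blast
  qed
qed (simp add: koszul_equiv_def)

lemma koszul_equiv_sym: "koszul_equiv X S T \<Longrightarrow> koszul_equiv X T S"
  unfolding koszul_equiv_def by (blast intro: mf_equiv_sym)

lemma koszul_equiv_trans [trans]:
  assumes "koszul_equiv X S T" "koszul_equiv X T U"
  shows "koszul_equiv X S U"
proof -
  obtain xs ys zs where "S = mset xs" "T = mset ys" "U = mset zs"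
    by (metis ex_mset)
  then show ?thesis using assms mf_equiv_trans by (auto simp: koszul_equiv_mset)
qed

lemma koszul_equiv_add:
  assumes "mf_equiv X (koszul xs) (koszul ys)"
  shows "koszul_equiv X (mset xs + S) (mset ys + S)"
proof -
  obtain zs where S: "S = mset zs"
    by (metis ex_mset)
  have "mf_equiv X (koszul (xs @ zs)) (koszul (ys @ zs))"
    unfolding koszul_def map_append using assms
    by (intro mf_equiv_tensor_list_cong) (auto simp: wf_koszul_row koszul_def)
  then show ?thesis
    using koszul_equiv_mset[of X "xs @ zs" "ys @ zs"] by (simp add: S)
qed

lemma koszul_one:
  assumes "mf_equiv X (koszul_row r) (koszul_row r')"
  shows "koszul_equiv X (add_mset r S) (add_mset r' S)"
proof -
  have "mf_equiv X (koszul [r]) (koszul [r'])"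
    using assms by (auto simp: koszul_def intro!: mf_equiv_tensor_left wf_mf_finite wf_mf_unit)
  then show ?thesis using koszul_equiv_add[of X "[r]" "[r']" S] by simp
qed

lemma koszul_two:
  assumes "mf_equiv X (mf_tensor (koszul_row r1) (koszul_row r2)) (mf_tensor (koszul_row r1') (koszul_row r2'))"
  shows "koszul_equiv X (add_mset r1 (add_mset r2 S)) (add_mset r1' (add_mset r2' S))"
proof -
  have "mf_equiv X (koszul [r1, r2]) (mf_tensor (mf_tensor (koszul_row r1) (koszul_row r2)) mf_unit)"
    unfolding koszul_def by (auto intro!: mf_equiv_sym[OF mf_equiv_tensor_assoc] wf_koszul_row wf_mf_unit)
  also have "mf_equiv X \<dots> (mf_tensor (mf_tensor (koszul_row r1') (koszul_row r2')) mf_unit)"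
    using assms by (intro mf_equiv_tensor_left wf_mf_finite wf_mf_unit)
  also have "mf_equiv X \<dots> (koszul [r1', r2'])"
    unfolding koszul_def by (auto intro!: mf_equiv_tensor_assoc wf_koszul_row wf_mf_unit)
  finally show ?thesis
    using koszul_equiv_add[of X "[r1, r2]" "[r1', r2']" S] by simp
qed

section \<open>Elementary operations on one or two rows\<close>

text \<open>The degree \<open>d - 4\<close> of the odd generator is half of
  \<open>d - (8 - d)\<close>.\<close>

lemma koszul_row_simps:
  "mf_gens (koszul_row (d, A, B)) = {Even_gen, Odd_gen}"
  "mf_odd (koszul_row (d, A, B)) = (\<lambda>g. g = Odd_gen)"
  "mf_deg (koszul_row (d, A, B)) = (\<lambda>g. if g = Odd_gen then d - 4 else 0)"
  "mf_coef (koszul_row (d, A, B)) = (\<lambda>h g. if h = Odd_gen \<and> g = Even_gen then A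
                     else if h = Even_gen \<and> g = Odd_gen then B else 0)"
  by (auto simp: koszul_row_def elem_mf_def)

lemma gens_koszul_row_tensor:
  "mf_gens (mf_tensor (koszul_row (d, A, B)) (koszul_row (d', A', B'))) =
    {Tensor_gen Even_gen Even_gen, Tensor_gen Even_gen Odd_gen,
     Tensor_gen Odd_gen Even_gen, Tensor_gen Odd_gen Odd_gen}"
  by (auto simp: koszul_row_simps)

lemma tensor_odd_cong:
  assumes "mf_odd M = mf_odd M'" "mf_odd N = mf_odd N'"
  shows "tensor_odd M N = tensor_odd M' N'"
proof
  show "tensor_odd M N g = tensor_odd M' N' g" for g using assms by (cases g) auto
qed

lemma tensor_deg_cong:
  assumes "mf_deg M = mf_deg M'" "mf_deg N = mf_deg N'"
  shows "tensor_deg M N = tensor_deg M' N'"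
proof
  show "tensor_deg M N g = tensor_deg M' N' g" for g using assms by (cases g) auto
qed

text \<open>
  With \<open>d = \<Sum>\<^sub>i A\<^sub>i \<theta>\<^sub>i + B\<^sub>i \<partial>\<^sub>i\<close> on the exterior algebra of \<open>\<theta>\<^sub>1, \<theta>\<^sub>2\<close>, the following three lemmas are conjugation
  with the automorphisms that send \<open>\<theta>\<^sub>2\<close> to \<open>\<theta>\<^sub>2 - l \<theta>\<^sub>1\<close>, \<open>1\<close> to \<open>1 + l \<theta>\<^sub>1 \<theta>\<^sub>2\<close>, and \<open>\<theta>\<^sub>1 \<theta>\<^sub>2\<close> to \<open>\<theta>\<^sub>1 \<theta>\<^sub>2 - l\<close>,
  and fix the other basis elements.
\<close>

lemma koszul_add_rows:
  assumes "l \<in> poly_ring X" "homog (d2 - d1) l"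
    and "M = add_mset (d1, A1, B1) (add_mset (d2, A2, B2) S)"
    and "N = add_mset (d1, A1 - l * A2, B1) (add_mset (d2, A2, B2 + l * B1) S)"
  shows "koszul_equiv X M N"
  unfolding assms(3,4)
proof (intro koszul_two mat_iso_imp_mf_equiv mat_iso_elementary[where c = "- l" and
      p = "Tensor_gen Odd_gen Even_gen" and q = "Tensor_gen Even_gen Odd_gen"])
  show "homog (mf_deg (mf_tensor (koszul_row (d1, A1, B1)) (koszul_row (d2, A2, B2))) (Tensor_gen Even_gen Odd_gen) -
      mf_deg (mf_tensor (koszul_row (d1, A1, B1)) (koszul_row (d2, A2, B2))) (Tensor_gen Odd_gen Even_gen)) (- l)"
    using assms(2) by (simp add: koszul_row_simps homog_minus)
qed (use assms(1) in \<open>auto simp: gens_koszul_row_tensor koszul_row_simps poly_ring_minus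
     simp del: mf_tensor_simps(1) intro!: tensor_odd_cong tensor_deg_cong\<close>)

lemma koszul_add_right:
  assumes "l \<in> poly_ring X" "homog (8 - d1 - d2) l"
    and "M = add_mset (d1, A1, B1) (add_mset (d2, A2, B2) S)"
    and "N = add_mset (d1, A1 + l * B2, B1) (add_mset (d2, A2 - l * B1, B2) S)"
  shows "koszul_equiv X M N"
  unfolding assms(3,4)
proof (intro koszul_two mat_iso_imp_mf_equiv mat_iso_elementary[where c = l and
      p = "Tensor_gen Odd_gen Odd_gen" and q = "Tensor_gen Even_gen Even_gen"])
  show "homog (mf_deg (mf_tensor (koszul_row (d1, A1, B1)) (koszul_row (d2, A2, B2))) (Tensor_gen Even_gen Even_gen) -
      mf_deg (mf_tensor (koszul_row (d1, A1, B1)) (koszul_row (d2, A2, B2))) (Tensor_gen Odd_gen Odd_gen)) l"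
    using assms(2) by (simp add: koszul_row_simps algebra_simps)
qed (use assms(1) in \<open>auto simp: gens_koszul_row_tensor koszul_row_simps poly_ring_minus
     simp del: mf_tensor_simps(1) intro!: tensor_odd_cong tensor_deg_cong\<close>)

lemma koszul_add_left:
  assumes "l \<in> poly_ring X" "homog (d1 + d2 - 8) l"
    and "M = add_mset (d1, A1, B1) (add_mset (d2, A2, B2) S)"
    and "N = add_mset (d1, A1, B1 + l * A2) (add_mset (d2, A2, B2 - l * A1) S)"
  shows "koszul_equiv X M N"
  unfolding assms(3,4)
proof (intro koszul_two mat_iso_imp_mf_equiv mat_iso_elementary[where c = "- l" and
      p = "Tensor_gen Even_gen Even_gen" and q = "Tensor_gen Odd_gen Odd_gen"])
  show "homog (mf_deg (mf_tensor (koszul_row (d1, A1, B1)) (koszul_row (d2, A2, B2))) (Tensor_gen Odd_gen Odd_gen) -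
      mf_deg (mf_tensor (koszul_row (d1, A1, B1)) (koszul_row (d2, A2, B2))) (Tensor_gen Even_gen Even_gen)) (- l)"
    using assms(2) by (simp add: koszul_row_simps algebra_simps homog_minus)
qed (use assms(1) in \<open>auto simp: gens_koszul_row_tensor koszul_row_simps poly_ring_minus
     simp del: mf_tensor_simps(1) intro!: tensor_odd_cong tensor_deg_cong\<close>)

text \<open>Exchanging the two generators yields the other row shifted in parity; the factor
  \<open>- r\<close> on the even generator absorbs the signs of \<open>shift_1\<close> and carries
  the constant across. Degree 4 puts both generators in degree 0, so the other grading is not
  shifted. Of the row operations this alone changes the parity.\<close>

lemma koszul_swap_columns:
  assumes r: "r \<noteq> 0" and M: "M = add_mset (4, Const r * A, B) S" "N = add_mset (4, Const r * B, A) S"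
  shows "koszul_equiv X M N"
proof -
  let ?\<phi> = "\<lambda>g. if g = Even_gen then Odd_gen else Even_gen"
  have "mat_iso X (koszul_row (4, Const r * A, B)) (shift_1 (koszul_row (4, Const r * B, A)))"
  proof (rule mat_iso_monomial[where \<phi> = ?\<phi> and c = "\<lambda>g. if g = Even_gen then - r else 1"])
    show "bij_betw ?\<phi> (mf_gens (koszul_row (4, Const r * A, B)))
        (mf_gens (shift_1 (koszul_row (4, Const r * B, A))))"
      by (auto simp: bij_betw_def inj_on_def koszul_row_simps)
  qed (use r in \<open>auto simp: koszul_row_simps Const_minus split: if_splits\<close>)
  then show ?thesis
    unfolding M by (intro koszul_one) (simp add: mf_equiv_def)
qed

section \<open>Exchanging two vertices\<close>

text \<open>The given pairing is brought to an intermediate matrix that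
  \<open>koszul_exchange_target\<close> reaches from the exchanged one. With abstract entries only
  the row operations have to be followed; \<open>T\<close> collects all their effects on the right
  entry opposite \<open>U\<close>.\<close>

lemma koszul_exchange_source:
  fixes q :: "'e mpoly"
  assumes ring: "q \<in> poly_ring X" "l \<in> poly_ring X" "k \<in> poly_ring X" "k' \<in> poly_ring X"
    and homog: "homog 0 q" "homog 2 l" "homog 4 k" "homog 4 k'"
    and U: "U = A3 - A3'" and S2: "S2 = B2 + B2'" and S3: "S3 = B3 + B3'"
    and D1: "D1 = B1 + q * U" "D1' = B1' - q * U"
    and D2: "A2 - A2' - l * U + 2 * S2 = 4 * D2"
    and C1: "C1 = A1 + k * U" "C1' = A1' - k' * U"
    and T: "T = B3 - q * A1 + q * A1' + l * B2 - k * D1 + k' * D1'"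
  shows "koszul_equiv X
    {#(2, A1, B1), (4, A2, B2), (6, A3, B3), (2, A1', B1'), (4, A2', B2'), (6, A3', B3')#}
    {#(2, C1, D1), (2, C1', D1'), (4, 4 * B2, D2), (4, A2' - 2 * B2, S2), (6, U, T), (6, A3', S3)#}"
    (is "koszul_equiv X ?M ?N")
proof -
  have "koszul_equiv X ?M
     {#(2, A1, B1), (4, A2, B2), (6, U, B3), (2, A1', B1'), (4, A2', B2'), (6, A3', S3)#}"
    by (rule koszul_add_rows[where l = 1 and ?A1.0 = A3 and ?B1.0 = B3 and ?A2.0 = A3' and ?B2.0 = B3'
          and ?d1.0 = 6 and ?d2.0 = 6
          and S = "{#(2, A1, B1), (4, A2, B2), (2, A1', B1'), (4, A2', B2')#}"])
       (simp_all add: U S3 add_mset_commute add.commute)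
  \<comment> \<open>With \<open>U\<close> isolated as a left entry, multiples of it correct the
    right entries of the first rows to \<open>D1\<close> and, next, \<open>D1'\<close>.\<close>
  also have "koszul_equiv X \<dots>
     {#(2, A1, D1), (4, A2, B2), (6, U, B3 - q * A1), (2, A1', B1'), (4, A2', B2'), (6, A3', S3)#}"
    by (rule koszul_add_left[where l = q and ?A1.0 = A1 and ?B1.0 = B1 and ?A2.0 = U and ?B2.0 = B3
          and ?d1.0 = 2 and ?d2.0 = 6
          and S = "{#(4, A2, B2), (2, A1', B1'), (4, A2', B2'), (6, A3', S3)#}"])
       (simp_all add: ring homog D1 add_mset_commute)
  also have "koszul_equiv X \<dots>
     {#(2, A1, D1), (4, A2, B2), (6, U, B3 - q * A1 + q * A1'), (2, A1', D1'), (4, A2', B2'), (6, A3', S3)#}"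
    by (rule koszul_add_left[where l = "- q" and ?A1.0 = A1' and ?B1.0 = B1' and ?A2.0 = U and ?B2.0 = "B3 - q * A1"
          and ?d1.0 = 2 and ?d2.0 = 6
          and S = "{#(2, A1, D1), (4, A2, B2), (4, A2', B2'), (6, A3', S3)#}"])
       (simp_all add: ring homog D1 add_mset_commute poly_ring_minus homog_minus)
  also have "koszul_equiv X \<dots>
     {#(2, A1, D1), (4, A2 - A2', B2), (6, U, B3 - q * A1 + q * A1'), (2, A1', D1'), (4, A2', S2), (6, A3', S3)#}"
    by (rule koszul_add_rows[where l = 1 and ?A1.0 = A2 and ?B1.0 = B2 and ?A2.0 = A2' and ?B2.0 = B2'
          and ?d1.0 = 4 and ?d2.0 = 4
          and S = "{#(2, A1, D1), (6, U, B3 - q * A1 + q * A1'), (2, A1', D1'), (6, A3', S3)#}"])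
       (simp_all add: S2 add_mset_commute add.commute)
  \<comment> \<open>Removing \<open>l * U\<close> here and adding \<open>2 * S2\<close> next turns
    \<open>A2 - A2'\<close> into \<open>4 * D2\<close>. The price is \<open>l * B2\<close> opposite
    \<open>U\<close> and \<open>- 2 * B2\<close> opposite \<open>S2\<close>.\<close>
  also have "koszul_equiv X \<dots>
     {#(2, A1, D1), (4, A2 - A2' - l * U, B2), (6, U, B3 - q * A1 + q * A1' + l * B2), (2, A1', D1'), (4, A2', S2), (6, A3', S3)#}"
    by (rule koszul_add_rows[where l = l and ?A1.0 = "A2 - A2'" and ?B1.0 = B2 and ?A2.0 = U and ?B2.0 = "B3 - q * A1 + q * A1'"
          and ?d1.0 = 4 and ?d2.0 = 6
          and S = "{#(2, A1, D1), (2, A1', D1'), (4, A2', S2), (6, A3', S3)#}"])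
       (simp_all add: ring homog add_mset_commute)
  also have "koszul_equiv X \<dots>
     {#(2, A1, D1), (4, 4 * D2, B2), (6, U, B3 - q * A1 + q * A1' + l * B2), (2, A1', D1'), (4, A2' - 2 * B2, S2), (6, A3', S3)#}"
    by (rule koszul_add_right[where l = 2 and ?A1.0 = "A2 - A2' - l * U" and ?B1.0 = B2 and ?A2.0 = A2' and ?B2.0 = S2
          and ?d1.0 = 4 and ?d2.0 = 4
          and S = "{#(2, A1, D1), (6, U, B3 - q * A1 + q * A1' + l * B2), (2, A1', D1'), (6, A3', S3)#}"])
       (simp_all add: D2 add_mset_commute)
  \<comment> \<open>The exchange of columns makes \<open>D2\<close> a right entry; the parity shift
    enters here.\<close>
  also have "koszul_equiv X \<dots>
     {#(2, A1, D1), (4, 4 * B2, D2), (6, U, B3 - q * A1 + q * A1' + l * B2), (2, A1', D1'), (4, A2' - 2 * B2, S2), (6, A3', S3)#}"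
    by (rule koszul_swap_columns[where r = 4 and A = D2 and B = B2
          and S = "{#(2, A1, D1), (6, U, B3 - q * A1 + q * A1' + l * B2), (2, A1', D1'), (4, A2' - 2 * B2, S2), (6, A3', S3)#}"])
       (simp_all add: Const_numeral add_mset_commute)
  \<comment> \<open>The remaining two operations correct the left entries of the first rows to
    \<open>C1\<close> and \<open>C1'\<close> by multiples of \<open>U\<close>, at the cost of
    multiples of \<open>D1\<close> and \<open>D1'\<close> opposite \<open>U\<close>.\<close>
  also have "koszul_equiv X \<dots>
     {#(2, C1, D1), (4, 4 * B2, D2), (6, U, B3 - q * A1 + q * A1' + l * B2 - k * D1), (2, A1', D1'), (4, A2' - 2 * B2, S2), (6, A3', S3)#}"
    by (rule koszul_add_rows[where l = "- k" and ?A1.0 = A1 and ?B1.0 = D1 and ?A2.0 = U and ?B2.0 = "B3 - q * A1 + q * A1' + l * B2"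
          and ?d1.0 = 2 and ?d2.0 = 6
          and S = "{#(4, 4 * B2, D2), (2, A1', D1'), (4, A2' - 2 * B2, S2), (6, A3', S3)#}"])
       (simp_all add: ring homog C1 add_mset_commute poly_ring_minus homog_minus)
  also have "koszul_equiv X \<dots> ?N"
    by (rule koszul_add_rows[where l = k' and ?A1.0 = A1' and ?B1.0 = D1' and ?A2.0 = U and ?B2.0 = "B3 - q * A1 + q * A1' + l * B2 - k * D1"
          and ?d1.0 = 2 and ?d2.0 = 6
          and S = "{#(2, C1, D1), (4, 4 * B2, D2), (4, A2' - 2 * B2, S2), (6, A3', S3)#}"])
       (simp_all add: ring homog C1 T add_mset_commute)
  finally show ?thesis .
qed

text \<open>Here no columns are exchanged, which leaves a relative parity shift of one. The third
  left entry depends only on the (-)-vertex, so the two third entries trade places between the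
  pairings and \<open>U\<close> is now \<open>C3' - C3\<close>.\<close>

lemma koszul_exchange_target:
  fixes l :: "'e mpoly"
  assumes ring: "l \<in> poly_ring X" and homog: "homog 2 l"
    and U: "U = C3' - C3" and S2: "S2 = D2 + D2'" and S3: "S3 = D3 + D3'"
    and B2: "C2 - C2' + l * U + 2 * S2 = 4 * B2"
    and A2: "A2 = C2' - 2 * D2 - l * U"
    and T: "T = D3' - l * D2 + l * S2"
  shows "koszul_equiv X
    {#(2, C1, D1), (4, C2, D2), (6, C3, D3), (2, C1', D1'), (4, C2', D2'), (6, C3', D3')#}
    {#(2, C1, D1), (2, C1', D1'), (4, 4 * B2, D2), (4, A2, S2), (6, U, T), (6, C3, S3)#}"
    (is "koszul_equiv X ?M ?N")
proof -
  have "koszul_equiv X ?M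
     {#(2, C1, D1), (4, C2, D2), (6, C3, S3), (2, C1', D1'), (4, C2', D2'), (6, U, D3')#}"
    by (rule koszul_add_rows[where l = 1 and ?A1.0 = C3' and ?B1.0 = D3' and ?A2.0 = C3 and ?B2.0 = D3
          and ?d1.0 = 6 and ?d2.0 = 6
          and S = "{#(2, C1, D1), (4, C2, D2), (2, C1', D1'), (4, C2', D2')#}"])
       (simp_all add: U S3 add_mset_commute)
  also have "koszul_equiv X \<dots>
     {#(2, C1, D1), (4, C2 - C2', D2), (6, C3, S3), (2, C1', D1'), (4, C2', S2), (6, U, D3')#}"
    by (rule koszul_add_rows[where l = 1 and ?A1.0 = C2 and ?B1.0 = D2 and ?A2.0 = C2' and ?B2.0 = D2'
          and ?d1.0 = 4 and ?d2.0 = 4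
          and S = "{#(2, C1, D1), (6, C3, S3), (2, C1', D1'), (6, U, D3')#}"])
       (simp_all add: S2 add_mset_commute add.commute)
  also have "koszul_equiv X \<dots>
     {#(2, C1, D1), (4, C2 - C2' + l * U, D2), (6, C3, S3), (2, C1', D1'), (4, C2', S2), (6, U, D3' - l * D2)#}"
    by (rule koszul_add_rows[where l = "- l" and ?A1.0 = "C2 - C2'" and ?B1.0 = D2 and ?A2.0 = U and ?B2.0 = D3'
          and ?d1.0 = 4 and ?d2.0 = 6
          and S = "{#(2, C1, D1), (6, C3, S3), (2, C1', D1'), (4, C2', S2)#}"])
       (simp_all add: ring homog add_mset_commute poly_ring_minus homog_minus)
  also have "koszul_equiv X \<dots>
     {#(2, C1, D1), (4, 4 * B2, D2), (6, C3, S3), (2, C1', D1'), (4, C2' - 2 * D2, S2), (6, U, D3' - l * D2)#}"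
    by (rule koszul_add_right[where l = 2 and ?A1.0 = "C2 - C2' + l * U" and ?B1.0 = D2 and ?A2.0 = C2' and ?B2.0 = S2
          and ?d1.0 = 4 and ?d2.0 = 4
          and S = "{#(2, C1, D1), (6, C3, S3), (2, C1', D1'), (6, U, D3' - l * D2)#}"])
       (simp_all add: B2 add_mset_commute)
  \<comment> \<open>A multiple of \<open>U\<close> brings the left entry opposite \<open>S2\<close>
    to the value \<open>A2\<close> prescribed by the common form.\<close>
  also have "koszul_equiv X \<dots> ?N"
    by (rule koszul_add_rows[where l = l and ?A1.0 = "C2' - 2 * D2" and ?B1.0 = S2 and ?A2.0 = U and ?B2.0 = "D3' - l * D2"
          and ?d1.0 = 4 and ?d2.0 = 6
          and S = "{#(2, C1, D1), (4, 4 * B2, D2), (6, C3, S3), (2, C1', D1')#}"])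
       (simp_all add: ring homog A2 T add_mset_commute)
  finally show ?thesis .
qed

section \<open>Polynomial identities behind the exchange\<close>

lemma quarter_mult:
  fixes q z :: "'a :: comm_ring_1"
  assumes "4 * q = 1"
  shows "q * (4 * z) = z"
proof -
  have "q * (4 * z) = (4 * q) * z"
    by (simp only: mult_ac)
  then show ?thesis by (simp add: assms)
qed

text \<open>The left entry of a first row is \<open>G\<close>, and \<open>- 4 K\<close> is its divided difference in the last argument at \<open>s, t\<close>.\<close>

lemma exchange_identity:
  fixes q u b c s t :: "'a :: comm_ring_1"
  assumes q: "4 * q = 1"
  defines "G \<equiv> \<lambda>x x2 x3 s. x ^ 3 + x ^ 2 * s + x * s ^ 2 + s ^ 3 - 4 * x2 * (x + s) + 4 * x3
      - 4 * u * (x ^ 2 + x * s + s ^ 2 - 3 * x2) - 2 * b * (x + s) - 4 * c"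
    and "K \<equiv> \<lambda>x x2. x2 - q * (x ^ 2 + s ^ 2 + t ^ 2 + x * s + x * t + s * t) + u * (x + s + t) + q * (2 * b)"
  shows "G x x2 x3 t = G x x2 x3 s + K x x2 * (4 * (s - t))"
    and "y3 - s3 + (3 * u - s - t) * (y2 - s2) =
      x3 - s3 - q * G x x2 x3 s + q * G y y2 y3 t + (3 * u - s - t) * (x2 - s2) - K x x2 * (x - t) + K y y2 * (y - s)"
proof -
  have q': "q * (4 * z) = z" for z
    using q by (rule quarter_mult)
  \<comment> \<open>The ring laws alone do not know \<open>4 * q = 1\<close>; for
    \<open>4 * K\<close> the fractions are cleared and they suffice.\<close>
  have K: "4 * K x x2 = 4 * x2 - (x ^ 2 + s ^ 2 + t ^ 2 + x * s + x * t + s * t) + 4 * u * (x + s + t) + 2 * b" for x x2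
  proof -
    have "4 * (x2 - q * p + r + q * (2 * b)) = 4 * x2 - (4 * q) * p + 4 * r + (4 * q) * (2 * b)" for p r
      by (simp only: algebra_simps)
    then show ?thesis unfolding K_def q by (simp add: mult.assoc)
  qed
  show "G x x2 x3 t = G x x2 x3 s + K x x2 * (4 * (s - t))"
  proof -
    have "K x x2 * (4 * (s - t)) = (4 * K x x2) * (s - t)"
      by (simp add: algebra_simps)
    then show ?thesis
      unfolding K G_def by (simp add: algebra_simps power2_eq_square power3_eq_cube)
  qed
  \<comment> \<open>An identity free of fractions, multiplied by \<open>q\<close>; afterwards each
    \<open>q * 4\<close> cancels.\<close>
  have "q * (G y y2 y3 t - G x x2 x3 s - (4 * K x x2) * (x - t) + (4 * K y y2) * (y - s)) =
      q * (4 * ((y3 - x3) + (3 * u - s - t) * (y2 - x2)))"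
    unfolding K G_def by (rule arg_cong[where f = "\<lambda>z. q * z"])
      (simp add: algebra_simps power2_eq_square power3_eq_cube)
  moreover have "q * ((4 * K x x2) * (x - t)) = K x x2 * (x - t)" "q * ((4 * K y y2) * (y - s)) = K y y2 * (y - s)"
    using q'[of "K x x2 * (x - t)"] q'[of "K y y2 * (y - s)"] by (simp_all only: mult.assoc)
  ultimately show "y3 - s3 + (3 * u - s - t) * (y2 - s2) =
      x3 - s3 - q * G x x2 x3 s + q * G y y2 y3 t + (3 * u - s - t) * (x2 - s2) - K x x2 * (x - t) + K y y2 * (y - s)"
    unfolding q' by (simp add: right_diff_distrib distrib_left) (simp add: algebra_simps)
qed

lemma pow_quot_4: "pow_quot 4 x y = x ^ 3 + x ^ 2 * y + x * y ^ 2 + y ^ 3"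
  by (simp add: pow_quot_def eval_nat_numeral algebra_simps)

lemma pow_quot_3: "pow_quot 3 x y = x ^ 2 + x * y + y ^ 2"
  by (simp add: pow_quot_def eval_nat_numeral algebra_simps)

definition graded_sym :: "'e var set \<Rightarrow> (nat \<Rightarrow> 'e mpoly) \<Rightarrow> bool" where
  "graded_sym X e \<longleftrightarrow> (\<forall>i\<in>{1, 2, 3}. e i \<in> poly_ring X \<and> homog (2 * int i) (e i))"

definition pair_rows :: "(nat \<Rightarrow> 'e mpoly) \<Rightarrow> (nat \<Rightarrow> 'e mpoly) \<Rightarrow> (int \<times> 'e mpoly \<times> 'e mpoly) list" where
  "pair_rows e s = [(2, g1_pol e s, e 1 - s 1), (4, g2_pol e s, e 2 - s 2), (6, g3_pol e s, e 3 - s 3)]"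

lemma pair_mf_koszul: "pair_mf e s = shift_1 (shift_q (- 3) (koszul (pair_rows e s)))"
  by (simp add: pair_mf_def koszul_def koszul_row_def pair_rows_def)

lemma wf_pair_mf: "wf_mf (pair_mf e s)"
  by (simp add: pair_mf_koszul wf_mf_shift_1 wf_mf_shift_q wf_koszul)

text \<open>Both pairings meet in one intermediate matrix, with \<open>U = 4 * (z - w)\<close> for
  the first symmetric polynomials \<open>z\<close>, \<open>w\<close> of the two
  (-)-vertices.\<close>

lemma koszul_pair_rows_exchange:
  fixes e e' s s' :: "nat \<Rightarrow> 'e mpoly"
  assumes sym: "graded_sym X e" "graded_sym X e'" "graded_sym X s" "graded_sym X s'"
    and X: "{Par_a, Par_b, Par_c} \<subseteq> X"
  shows "koszul_equiv X (mset (pair_rows e s @ pair_rows e' s')) (mset (pair_rows e s' @ pair_rows e' s))"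
proof -
  define x x2 x3 where x: "x = e 1" "x2 = e 2" "x3 = e 3"
  define y y2 y3 where y: "y = e' 1" "y2 = e' 2" "y3 = e' 3"
  define z z2 z3 where z: "z = s 1" "z2 = s 2" "z3 = s 3"
  define w w2 w3 where w: "w = s' 1" "w2 = s' 2" "w3 = s' 3"
  \<comment> \<open>Writing \<open>a\<close> as \<open>3 * u\<close> makes the coefficients of all
    left entries integral; the only other fraction is the quarter \<open>q\<close>, needed to turn
    \<open>U\<close> into \<open>z - w\<close>.\<close>
  define u b c where u: "u = Const (1/3) * Var (Par_a :: 'e var)"
    and b: "b = Var (Par_b :: 'e var)" and c: "c = Var (Par_c :: 'e var)"
  define q where "q = (Const (1/4) :: 'e mpoly)"
  have q4: "4 * q = 1"
    by (simp add: q_def Const_mult flip: Const_numeral)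
  have q': "q * (4 * p) = p" for p
    using q4 by (rule quarter_mult)
  have a: "Const (4/3) * Var Par_a = 4 * u" "Var Par_a = 3 * u"
    unfolding u by (rule Const_third)+
  define G where "G = (\<lambda>x x2 x3 s. x ^ 3 + x ^ 2 * s + x * s ^ 2 + s ^ 3 - 4 * x2 * (x + s) + 4 * x3
      - 4 * u * (x ^ 2 + x * s + s ^ 2 - 3 * x2) - 2 * b * (x + s) - 4 * c)"
  \<comment> \<open>\<open>k x x2 * U\<close> is what \<open>G\<close> gains when its last argument
    changes from \<open>z\<close> to \<open>w\<close>.\<close>
  define k where "k = (\<lambda>x x2. x2 - q * (x ^ 2 + z ^ 2 + w ^ 2 + x * z + x * w + z * w) + u * (x + z + w) + q * (2 * b))"
  have id1: "G x x2 x3 w = G x x2 x3 z + k x x2 * (4 * (z - w))" for x x2 x3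
    unfolding G_def k_def by (rule exchange_identity[OF q4])
  have id2: "y3 - z3 + (3 * u - z - w) * (y2 - z2) = x3 - z3 - q * G x x2 x3 z + q * G y y2 y3 w
      + (3 * u - z - w) * (x2 - z2) - k x x2 * (x - w) + k y y2 * (y - z)"
    unfolding G_def k_def by (rule exchange_identity[OF q4])
  have g1: "g1_pol f v = G (f 1) (f 2) (f 3) (v 1)" for f v
    unfolding g1_pol_def G_def a(1) pow_quot_4 pow_quot_3 b c by simp
  define H where "H = (\<lambda>x2 v v2. 2 * (x2 + v2) - 4 * v ^ 2 + 4 * (3 * u) * v + 4 * b)"
  have g2: "g2_pol f v = H (f 2) (v 1) (v 2)" for f v
    by (simp add: g2_pol_def H_def a b)
  have g3: "g3_pol f v = 4 * (v 1 - 3 * u)" for f v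
    by (simp add: g3_pol_def a)
  have rg: "x \<in> poly_ring X" "x2 \<in> poly_ring X" "y \<in> poly_ring X" "y2 \<in> poly_ring X" "z \<in> poly_ring X" "w \<in> poly_ring X"
    "u \<in> poly_ring X" "b \<in> poly_ring X" "q \<in> poly_ring X"
    using sym X by (auto simp: graded_sym_def x y z w u b q_def intro!: poly_ring_mult)
  have hm: "homog 2 x" "homog 4 x2" "homog 2 y" "homog 4 y2" "homog 2 z" "homog 2 w" "homog 0 q" "homog 4 b"
    using sym by (auto simp: graded_sym_def x y z w b q_def homog_params)
  have hu: "homog 2 u"
    unfolding u by (rule homog_mult[OF homog_Const homog_params(1)]) simp
  \<comment> \<open>This multiplier arises from the terms of \<open>H\<close> in its second
    argument: their difference at \<open>z\<close> and \<open>w\<close> is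
    \<open>(3 * u - z - w) * U\<close>.\<close>
  have lr: "3 * u - z - w \<in> poly_ring X"
    by (intro poly_ring_closed poly_ring_numeral rg)
  have lh: "homog 2 (3 * u - z - w)"
    by (intro homog_diff hm homog_mult[OF homog_numeral hu]) simp
  have kr: "k x x2 \<in> poly_ring X" if "x \<in> poly_ring X" "x2 \<in> poly_ring X" for x x2
    unfolding k_def using that by (intro poly_ring_closed poly_ring_numeral rg)
  have kh: "homog 4 (k x x2)" if h: "homog 2 x" "homog 4 x2" for x x2
    unfolding k_def
    by (intro homog_add homog_diff h homog_mult[OF hm(7)] homog_mult[OF hu, of 2] homog_mult[OF homog_numeral hm(8)]
          homog_mult[OF h(1)] homog_mult[OF hm(5)] homog_power hm) (auto intro: h hm)
  \<comment> \<open>The right entry opposite \<open>U\<close> as the target operations leave it,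
    after the terms in \<open>x2\<close> and \<open>w2\<close> cancel; \<open>id2\<close> says that
    the source operations produce the same.\<close>
  define T where "T = y3 - z3 + (3 * u - z - w) * (y2 - z2)"
  have S: "koszul_equiv X {#(2, G x x2 x3 z, x - z), (4, H x2 z z2, x2 - z2), (6, 4 * (z - 3 * u), x3 - z3),
       (2, G y y2 y3 w, y - w), (4, H y2 w w2, y2 - w2), (6, 4 * (w - 3 * u), y3 - w3)#}
     {#(2, G x x2 x3 w, x - w), (2, G y y2 y3 z, y - z), (4, 4 * (x2 - z2), x2 - w2),
       (4, H y2 w w2 - 2 * (x2 - z2), x2 - z2 + (y2 - w2)), (6, 4 * (z - w), T),
       (6, 4 * (w - 3 * u), x3 - z3 + (y3 - w3))#}"
  proof (rule koszul_exchange_source[where q = q and l = "3 * u - z - w" and k = "k x x2" and k' = "k y y2"])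
    show "H x2 z z2 - H y2 w w2 - (3 * u - z - w) * (4 * (z - w)) + 2 * (x2 - z2 + (y2 - w2)) = 4 * (x2 - w2)"
      unfolding H_def by (simp add: algebra_simps power2_eq_square)
    show "G y y2 y3 z = G y y2 y3 w - k y y2 * (4 * (z - w))"
      using id1[of y y2 y3] by simp
    show "x - w = x - z + q * (4 * (z - w))" "y - z = y - w - q * (4 * (z - w))"
      unfolding q' by simp_all
  qed (use rg hm lr lh kr kh id1 id2 in \<open>simp_all add: T_def q'\<close>)
  have "koszul_equiv X {#(2, G x x2 x3 w, x - w), (4, H x2 w w2, x2 - w2), (6, 4 * (w - 3 * u), x3 - w3),
       (2, G y y2 y3 z, y - z), (4, H y2 z z2, y2 - z2), (6, 4 * (z - 3 * u), y3 - z3)#}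
     {#(2, G x x2 x3 w, x - w), (2, G y y2 y3 z, y - z), (4, 4 * (x2 - z2), x2 - w2),
       (4, H y2 w w2 - 2 * (x2 - z2), x2 - z2 + (y2 - w2)), (6, 4 * (z - w), T),
       (6, 4 * (w - 3 * u), x3 - z3 + (y3 - w3))#}"
  proof (rule koszul_exchange_target[where l = "3 * u - z - w"])
    show "H x2 w w2 - H y2 z z2 + (3 * u - z - w) * (4 * (z - w)) + 2 * (x2 - z2 + (y2 - w2)) = 4 * (x2 - z2)"
      "H y2 w w2 - 2 * (x2 - z2) = H y2 z z2 - 2 * (x2 - w2) - (3 * u - z - w) * (4 * (z - w))"
      unfolding H_def by (simp_all add: algebra_simps power2_eq_square)
    show "T = y3 - z3 - (3 * u - z - w) * (x2 - w2) + (3 * u - z - w) * (x2 - z2 + (y2 - w2))"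
      unfolding T_def by (simp add: algebra_simps)
  qed (use lr lh in simp_all)
  note koszul_equiv_trans[OF S koszul_equiv_sym[OF this]]
  then show ?thesis
    unfolding pair_rows_def g1 g2 g3 by (simp only: mset.simps append.simps x y z w)
qed

lemma pair_mf_exchange:
  assumes "graded_sym X e" "graded_sym X e'" "graded_sym X s" "graded_sym X s'"
    and "{Par_a, Par_b, Par_c} \<subseteq> X"
  shows "mf_equiv X (mf_tensor_list [pair_mf e s, pair_mf e' s']) (mf_tensor_list [pair_mf e s', pair_mf e' s])"
proof -
  let ?K = "\<lambda>e s. koszul (pair_rows e s)"
  note [simp] = wf_koszul wf_mf_shift_1 wf_mf_shift_q wf_mf_unit wf_mf_tensor
  have pair: "mf_equiv X (mf_tensor (pair_mf e s) (mf_tensor (pair_mf f t) mf_unit))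
      (shift_q (- 6) (koszul (pair_rows e s @ pair_rows f t)))" for e s f t
  proof -
    let ?M = "shift_q (- 3) (?K e s)" and ?N = "shift_q (- 3) (?K f t)"
    \<comment> \<open>The unit that ends the list is first moved to the left, where
      \<open>mat_iso_unit_tensor\<close> removes it.\<close>
    have "mf_equiv X (mf_tensor (pair_mf f t) mf_unit) (mf_tensor mf_unit (pair_mf f t))"
      by (intro mat_iso_imp_mf_equiv mat_iso_tensor_commute) (simp_all add: wf_pair_mf)
    also have "mf_equiv X \<dots> (pair_mf f t)"
      by (intro mat_iso_imp_mf_equiv mat_iso_unit_tensor wf_mf_finite wf_pair_mf)
    also have "mf_equiv X \<dots> ?N"
      unfolding pair_mf_koszul by (intro mf_equiv_shift_1 wf_mf_finite) simp
    finally have "mf_equiv X (mf_tensor (pair_mf e s) (mf_tensor (pair_mf f t) mf_unit)) (mf_tensor (pair_mf e s) ?N)"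
      by (intro mf_equiv_tensor_right wf_pair_mf)
    also have "mf_equiv X \<dots> (mf_tensor ?M ?N)"
      unfolding pair_mf_koszul by (intro mf_equiv_tensor_left mf_equiv_shift_1 wf_mf_finite) simp_all
    also have "mf_equiv X \<dots> (shift_q (- 6) (mf_tensor (?K e s) (?K f t)))"
      using mat_iso_imp_mf_equiv[OF mat_iso_tensor_shift_q[of "?K e s" "?K f t" X "- 3" "- 3"]]
      by (simp add: wf_mf_finite del: mf_tensor_simps)
    also have "mf_equiv X \<dots> (shift_q (- 6) (koszul (pair_rows e s @ pair_rows f t)))"
      unfolding koszul_def map_append
      by (intro mf_equiv_shift_q mf_equiv_sym[OF mf_equiv_tensor_list_append]) (auto simp: wf_koszul_row)
    finally show ?thesis .
  qed
  have "mf_equiv X (koszul (pair_rows e s @ pair_rows e' s')) (koszul (pair_rows e s' @ pair_rows e' s))"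
    using koszul_pair_rows_exchange[OF assms] unfolding koszul_equiv_mset .
  then have "mf_equiv X (shift_q (- 6) (koszul (pair_rows e s @ pair_rows e' s')))
      (shift_q (- 6) (koszul (pair_rows e s' @ pair_rows e' s)))"
    by (rule mf_equiv_shift_q)
  from mf_equiv_trans[OF mf_equiv_trans[OF pair this] mf_equiv_sym[OF pair]] show ?thesis
    by simp
qed

section \<open>Arbitrary identifications\<close>

text \<open>Induction on \<open>es\<close>: one exchange gives the head of \<open>es\<close> its new
  partner, and the rest is again a rearrangement. Since the lists hold symmetric polynomials rather
  than vertices, repetitions are allowed.\<close>

lemma mf_equiv_pairing_perm:
  assumes "length es = length ss" "mset ss = mset ss'"
    and "\<And>e. e \<in> set es \<union> set ss \<Longrightarrow> graded_sym X e" and X: "{Par_a, Par_b, Par_c} \<subseteq> X"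
  shows "mf_equiv X (mf_tensor_list (map2 pair_mf es ss)) (mf_tensor_list (map2 pair_mf es ss'))"
  using assms(1-3)
proof (induction es arbitrary: ss ss')
  case Nil
  then show ?case by (auto intro!: mf_equiv_refl wf_mf_finite wf_mf_unit)
next
  case (Cons e es)
  from Cons.prems(1) obtain s ss1 where ss: "ss = s # ss1" "length es = length ss1"
    by (cases ss) auto
  moreover from Cons.prems(2) this obtain s' ss1' where ss': "ss' = s' # ss1'"
    by (cases ss') auto
  have perm: "set ss = set ss'"
    using Cons.prems(2) by (metis set_mset_mset)
  show ?case
  proof (cases "s = s'")
    case True
    then have "mf_equiv X (mf_tensor_list (map2 pair_mf es ss1)) (mf_tensor_list (map2 pair_mf es ss1'))"
      using Cons.prems ss ss' by (intro Cons.IH) auto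
    then show ?thesis
      using True by (auto simp: ss ss' intro: mf_equiv_tensor_right wf_pair_mf)
  next
    case False
    then have "s' \<in> set ss1"
      using perm ss ss' by auto
    then obtain As Bs where ss1: "ss1 = As @ s' # Bs"
      by (auto simp: in_set_conv_decomp)
    \<comment> \<open>Cutting \<open>es\<close> at the position of \<open>s'\<close> in
      \<open>ss1\<close> produces the entry \<open>e'\<close> that is paired with
      \<open>s'\<close>.\<close>
    define Ae where "Ae = take (length As) es"
    obtain e' Be where es: "es = Ae @ e' # Be"
      using ss ss1 id_take_nth_drop[of "length As" es] by (auto simp: Ae_def)
    have "length Ae = length As"
      using ss ss1 by (simp add: Ae_def)
    moreover have "length es = length Ae + Suc (length Be)"
      by (subst es) simp
    ultimately have len: "length Ae = length As" "length Be = length Bs"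
      using ss ss1 by simp_all
    let ?L = "map2 pair_mf Ae As" and ?R = "map2 pair_mf Be Bs"
    have wfs: "wf_mf M" if "M \<in> set (pair_mf f t # pair_mf f' t' # ?L @ ?R)" for M f t f' t'
      using that by (auto simp: wf_pair_mf)
    have eq: "map2 pair_mf (f # es) (t # As @ t' # Bs) = pair_mf f t # ?L @ pair_mf e' t' # ?R" for f t t'
      using len by (simp add: es)
    \<comment> \<open>Bringing the two affected factors to the front isolates them; the same
      reordering, read backwards, serves after the exchange.\<close>
    have move: "mf_equiv X (mf_tensor_list (map2 pair_mf (f # es) (t # As @ t' # Bs)))
        (mf_tensor_list ([pair_mf f t, pair_mf e' t'] @ ?L @ ?R))" for f t t'
      unfolding eq using wfs by (intro mf_equiv_tensor_list_perm) auto
    have "mf_equiv X (mf_tensor_list ([pair_mf e s, pair_mf e' s'] @ ?L @ ?R))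
        (mf_tensor_list ([pair_mf e s', pair_mf e' s] @ ?L @ ?R))"
      using Cons.prems X wfs
      by (intro mf_equiv_tensor_list_cong pair_mf_exchange) (auto simp: ss ss1 es wf_pair_mf)
    from mf_equiv_trans[OF mf_equiv_trans[OF move this] mf_equiv_sym[OF move]]
    have "mf_equiv X (mf_tensor_list (map2 pair_mf (e # es) ss))
        (mf_tensor_list (map2 pair_mf (e # es) (s' # As @ s # Bs)))"
      by (simp only: ss(1) ss1)
    moreover have "mf_equiv X (mf_tensor_list (map2 pair_mf es (As @ s # Bs))) (mf_tensor_list (map2 pair_mf es ss1'))"
      using Cons.prems ss ss' ss1 by (intro Cons.IH) auto
    then have "mf_equiv X (mf_tensor_list (map2 pair_mf (e # es) (s' # As @ s # Bs)))
        (mf_tensor_list (map2 pair_mf (e # es) ss'))"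
      by (auto simp: ss' intro: mf_equiv_tensor_right wf_pair_mf)
    ultimately show ?thesis
      by (rule mf_equiv_trans)
  qed
qed

lemma wf_arc_mf: "wf_mf (arc_mf x)"
  by (simp add: arc_mf_def wf_mf_elem Let_def split: prod.split)

text \<open>Both identifications are bijections onto the (-)-vertices, so along one list of
  (+)-vertices their lists of partners are rearrangements of each other.\<close>

lemma mf_equiv_identified_mf:
  fixes \<Gamma> :: "('v, 'e) web"
  assumes sym: "\<And>v. v \<in> plus_verts \<Gamma> \<Longrightarrow> graded_sym X (out_esym \<Gamma> v)"
      "\<And>v. v \<in> minus_verts \<Gamma> \<Longrightarrow> graded_sym X (in_esym \<Gamma> v)"
    and X: "{Par_a, Par_b, Par_c} \<subseteq> X"
    and \<zeta>: "complete_identification \<Gamma> \<zeta>" "complete_identification \<Gamma> \<zeta>'"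
    and as: "mset as = mset as'" and vs: "distinct vs" "set vs = plus_verts \<Gamma>" "mset vs = mset vs'"
  shows "mf_equiv X (identified_mf \<Gamma> as vs \<zeta>) (identified_mf \<Gamma> as' vs' \<zeta>')"
proof -
  let ?P = "\<lambda>\<zeta> v. pair_mf (out_esym \<Gamma> v) (in_esym \<Gamma> (\<zeta> v))"
  have wf: "wf_mf M" if "M \<in> set (map arc_mf as) \<union> set (map (?P \<zeta>) vs)" for M as vs \<zeta>
    using that by (auto simp: wf_arc_mf wf_pair_mf)
  have map2: "map (?P \<zeta>) vs = map2 pair_mf (map (out_esym \<Gamma>) vs) (map (in_esym \<Gamma>) (map \<zeta> vs))" for \<zeta>
    by (induction vs) auto
  have img: "distinct (map \<xi> vs)" "set (map \<xi> vs) = minus_verts \<Gamma>" if "complete_identification \<Gamma> \<xi>" for \<xi>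
    using that vs by (auto simp: complete_identification_def bij_betw_def distinct_map)
  have "mset (map \<zeta> vs) = mset (map \<zeta>' vs)"
    using img[OF \<zeta>(1)] img[OF \<zeta>(2)] by (metis set_eq_iff_mset_eq_distinct)
  then have "mset (map (in_esym \<Gamma>) (map \<zeta> vs)) = mset (map (in_esym \<Gamma>) (map \<zeta>' vs))"
    by (metis mset_map)
  then have pairs: "mf_equiv X (mf_tensor_list (map (?P \<zeta>) vs)) (mf_tensor_list (map (?P \<zeta>') vs))"
    unfolding map2 using X vs sym \<zeta>(1)
    by (intro mf_equiv_pairing_perm) (auto simp: complete_identification_def dest: bij_betwE)
  \<comment> \<open>The arcs go to the back, as the factors to be replaced must form an initial
    block.\<close>
  have "mf_equiv X (identified_mf \<Gamma> as vs \<zeta>) (mf_tensor_list (map (?P \<zeta>) vs @ map arc_mf as))"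
    unfolding identified_mf_def using wf by (intro mf_equiv_tensor_list_perm) auto
  also have "mf_equiv X \<dots> (mf_tensor_list (map (?P \<zeta>') vs @ map arc_mf as))"
    using pairs wf by (intro mf_equiv_tensor_list_cong) (auto simp: wf_arc_mf wf_pair_mf)
  also have "mf_equiv X \<dots> (identified_mf \<Gamma> as' vs' \<zeta>')"
    unfolding identified_mf_def using wf as vs(3) by (intro mf_equiv_tensor_list_perm) (auto simp: wf_arc_mf wf_pair_mf)
  finally show ?thesis .
qed

lemma graded_sym_esym:
  assumes "finite S" "\<And>e. e \<in> S \<Longrightarrow> f e \<in> poly_ring X \<and> homog 2 (f e)"
  shows "graded_sym X (esym f S)"
  using esym_ok[OF assms] by (simp add: graded_sym_def)

theorem proposition4p2:
  fixes \<Gamma> :: "('v, 'e) web"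
    and \<zeta> \<zeta>' :: "'v \<Rightarrow> 'v"
    and as as' :: "(('e \<times> nat) \<times> ('e \<times> nat)) list"
    and vs vs' :: "'v list"
  assumes "closed_web \<Gamma>"
    and "complete_identification \<Gamma> \<zeta>"
    and "complete_identification \<Gamma> \<zeta>'"
    and "distinct as" "set as = arcs \<Gamma>"
    and "distinct as'" "set as' = arcs \<Gamma>"
    and "distinct vs" "set vs = plus_verts \<Gamma>"
    and "distinct vs'" "set vs' = plus_verts \<Gamma>"
  shows "mf_isomorphic (web_ring \<Gamma>) (identified_mf \<Gamma> as vs \<zeta>) (identified_mf \<Gamma> as' vs' \<zeta>') \<or>
         mf_isomorphic (web_ring \<Gamma>) (identified_mf \<Gamma> as vs \<zeta>) (shift_1 (identified_mf \<Gamma> as' vs' \<zeta>'))"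
proof -
  define X where "X = ({Par_a, Par_b, Par_c} \<union>
                           {Mark e i |e i. e \<in> edges \<Gamma> \<union> circles \<Gamma> \<and> i < marks \<Gamma> e})"
  have R: "web_ring \<Gamma> = poly_ring X" by (simp add: web_ring_def X_def)
  have fin: "finite (edges \<Gamma>)" and mk: "\<And>e. e \<in> edges \<Gamma> \<union> circles \<Gamma> \<Longrightarrow> marks \<Gamma> e \<ge> 1"
    using assms(1) unfolding closed_web_def is_web_def by blast+
  \<comment> \<open>At least one mark per edge guarantees that the first mark, 0, and the last one,
    \<open>marks \<Gamma> e - 1\<close>, have variables in \<open>X\<close>.\<close>
  have "graded_sym X (out_esym \<Gamma> v)" "graded_sym X (in_esym \<Gamma> v)" for v
    unfolding out_esym_def in_esym_def using fin mk
    by (intro graded_sym_esym; fastforce simp: out_edges_def in_edges_def X_def intro: homog_params)+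
  moreover have "mset as = mset as'" "mset vs = mset vs'"
    using assms by (auto simp: set_eq_iff_mset_eq_distinct[symmetric])
  ultimately show ?thesis
    unfolding R using assms
    by (intro mf_equiv_imp_mf_isomorphic mf_equiv_identified_mf) (auto simp: X_def)
qed

end
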